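(* Consider the system $$\frac{dx}{dt}=\frac{\partial H}{\partial y},\quad \frac{dy}{dt}=-\frac{\partial H}{\partial x},\quad \frac{dz}{dt}=\frac{\partial H}{\partial w},\quad \frac{dw}{dt}=-\frac{\partial H}{\partial z},\quad \frac{dq}{dt}=\frac{\partial H}{\partial p},\quad \frac{dp}{dt}=-\frac{\partial H}{\partial q},$$ with $H$ the polynomial Hamiltonian given in the context and parameters satisfying $\alpha_0+\alpha_1+\alpha_2+\alpha_3=1$. This system admits the affine Weyl group symmetry of type $D_4^{(2)}$ as the group of its Bäcklund transformations, whose generators $s_0,s_1,s_2,s_3$ are defined as follows: with $( * ):=(x,y,z,w,q,p,t;\alpha_0,\alpha_1,\alpha_2,\alpha_3)$ and $f_2:=w+p+\frac{y}{2}+\frac{xz}{2}-\frac{zq}{4}+t$, $$\begin{aligned} s_0:( * )\to&\Big(x+\frac{\alpha_0}{y+z^2/4},\,y,\,z,\,w-\frac{\alpha_0 z}{2(y+z^2/4)},\,q,\,p,\,t;\,-\alpha_0,\,\alpha_1+2\alpha_0,\,\alpha_2,\,\alpha_3\Big),\\ s_1:( * )\to&\Big(x,\,y,\,z+\frac{\alpha_1}{w},\,w,\,q,\,p,\,t;\,\alpha_0+\alpha_1,\,-\alpha_1,\,\alpha_2+\alpha_1,\,\alpha_3\Big),\\ s_2:( * )\to&\Big(x+\frac{\alpha_2/2}{f_2},\,y-\frac{\alpha_2 z/2}{f_2}-\frac{\alpha_2^2/4}{f_2^2},\,z+\frac{\alpha_2}{f_2},\,w+\frac{\alpha_2(q-2x)/4}{f_2},\,q+\frac{\alpha_2}{f_2},\\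 &\quad p+\frac{\alpha_2 z/4}{f_2}+\frac{\alpha_2^2/8}{f_2^2},\,t;\,\alpha_0,\,\alpha_1+\alpha_2,\,-\alpha_2,\,\alpha_3+\alpha_2\Big),\\ s_3:( * )\to&\Big(x,\,y,\,z,\,w,\,q+\frac{\alpha_3}{p},\,p,\,t;\,\alpha_0,\,\alpha_1,\,\alpha_2+2\alpha_3,\,-\alpha_3\Big). \end{aligned}$$ That is, each $s_i$ $(i=0,1,2,3)$ is a Bäcklund transformation of the system (it carries the system with parameters $(\alpha_0,\alpha_1,\alpha_2,\alpha_3)$ to the system of the same form with the transformed parameters), and $s_0,s_1,s_2,s_3$ are generators of a group of Bäcklund transformations that is the affine Weyl group of type $D_4^{(2)}$, with $s_0,\dots,s_3$ corresponding to its simple reflections.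
   Context: Here $x,y,z,w,q,p$ are unknown complex variables (functions of $t$), and $\alpha_0,\alpha_1,\alpha_2,\alpha_3$ are complex parameters, constant in $t$, satisfying $\alpha_0+\alpha_1+\alpha_2+\alpha_3=1$. The Hamiltonian is $$\begin{aligned} H=&\frac{1}{4t}y^3+\frac{3}{2}y^2+\frac{3\alpha_3-1}{t}xy+\frac{3}{4t}z^2w^2+\frac{3}{2}z^2w+\frac{3\alpha_1+3\alpha_2-2}{2t}zw+\frac{3}{2}\alpha_1 z\\ &-\frac{4}{t}p^3-6p^2-\frac{3\alpha_1+3\alpha_2+3\alpha_3-2}{t}qp-6tp+\frac{3}{4t}\alpha_1(8xp+2zp+yz)+\frac{6}{t}\alpha_2xp\\ &+\frac{3}{2t}\alpha_3(4xp-yq)+\frac{3}{4t}\big(8xyqp-4zwqp+8xzwp-8x^2yp+2z^2wp+yz^2w\\ &-2yq^2p+8w^2p-4yp^2+4yw^2+4y^2w+8ywp-8xp+8tyw\big). \end{aligned}$$ Each $s_i$ is regarded as an automorphism of the field of rational functions in $x,y,z,w,q,p,t$ and the parameters $\alpha_0,\dots,\alpha_3$ (subject to $\sum_i\alpha_i=1$), sending each listed variable to the displayed expression. It is a Bäcklund transformation of the system if it commutes with the derivation $d/dt$ of that field determined by the system (with $dt/dt=1$, $d\alpha_i/dt=0$); equivalently, generic solutions for parameters $(\alpha_i)$ are mapped to solutions for parameters $(s_i(\alpha_0),\dots,s_i(\alpha_3))$. The affine Weyl group of type $D_4^{(2)}$ is the Coxeter group with generators $s_0,s_1,s_2,s_3$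 and defining relations $s_i^2=1$, $(s_0s_1)^4=(s_2s_3)^4=1$, $(s_1s_2)^3=1$, $(s_0s_2)^2=(s_0s_3)^2=(s_1s_3)^2=1$. *)

theory Defs
  imports
    "HOL-Algebra.Algebra"
    "HOL-Library.Poly_Mapping"
    "HOL-Computational_Algebra.Fraction_Field"
begin

section \<open>The field of rational functions\<close>

(* The parameter alpha_0 is eliminated by alpha_0 + alpha_1 + alpha_2 + alpha_3 = 1; the remaining
   ten variables are algebraically independent. *)
datatype var = VX | VY | VZ | VW | VQ | VP | VT | VA1 | VA2 | VA3

(* Position of a variable in the list (x,y,z,w,q,p,t,alpha_0,alpha_1,alpha_2,alpha_3); position 7
   belongs to alpha_0. *)
fun position :: "var \<Rightarrow> nat" where
  "position VX = 0" | "position VY = 1" | "position VZ = 2" | "position VW = 3" | "position VQ = 4" | "position VP = 5"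
| "position VT = 6" | "position VA1 = 8" | "position VA2 = 9" | "position VA3 = 10"

lemma UNIV_var: "UNIV = {VX, VY, VZ, VW, VQ, VP, VT, VA1, VA2, VA3}"
proof -
  have "v \<in> {VX, VY, VZ, VW, VQ, VP, VT, VA1, VA2, VA3}" for v by (cases v) auto
  then show ?thesis by blast
qed

lemma position_inject: "position u = position v \<Longrightarrow> u = v"
  by (cases u; cases v) simp_all

instance var :: finite
  by standard (simp add: UNIV_var)

(* The order on variables has no mathematical role; it is what the library asks for to
   recognise the polynomials over these variables as an integral domain. *)
instantiation var :: linorder
begin
definition less_eq_var :: "var \<Rightarrow> var \<Rightarrow> bool" where "less_eq_var u v \<longleftrightarrow> position u \<le> position v"
definition less_var :: "var \<Rightarrow> var \<Rightarrow> bool" where "less_var u v \<longleftrightarrow> position u < position v"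
instance
  by standard (auto simp: less_eq_var_def less_var_def dest: position_inject)
end

type_synonym mono = "var \<Rightarrow>\<^sub>0 nat"
type_synonym mpol = "mono \<Rightarrow>\<^sub>0 complex"
type_synonym ratfun = "mpol fract"

definition cst :: "complex \<Rightarrow> ratfun" where
  "cst c = Fract (Poly_Mapping.single 0 c) 1"

definition indet :: "var \<Rightarrow> ratfun" where
  "indet v = Fract (Poly_Mapping.single (Poly_Mapping.single v 1) 1) 1"

abbreviation alpha0 :: ratfun where
  "alpha0 \<equiv> 1 - indet VA1 - indet VA2 - indet VA3"

definition coords :: "ratfun list" where
  "coords = [indet VX, indet VY, indet VZ, indet VW, indet VQ, indet VP, indet VT,
             alpha0, indet VA1, indet VA2, indet VA3]"


section \<open>Partial derivatives\<close>

definition pd_poly :: "var \<Rightarrow> mpol \<Rightarrow> mpol" where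
  "pd_poly v a = (\<Sum>m\<in>Poly_Mapping.keys a. Poly_Mapping.single (m - Poly_Mapping.single v 1)
                                   (of_nat (Poly_Mapping.lookup m v) * Poly_Mapping.lookup a m))"

(* Quotient rule; independence of the chosen representation is lemma pd_Fract. *)
definition pd :: "var \<Rightarrow> ratfun \<Rightarrow> ratfun" where
  "pd v f = (THE g. \<exists>a b. b \<noteq> 0 \<and> f = Fract a b \<and>
                      g = Fract (pd_poly v a * b - a * pd_poly v b) (b * b))"

lemma pd_poly_superset:
  assumes "finite S" "Poly_Mapping.keys a \<subseteq> S"
  shows "pd_poly v a = (\<Sum>m\<in>S. Poly_Mapping.single (m - Poly_Mapping.single v 1)
                                   (of_nat (Poly_Mapping.lookup m v) * Poly_Mapping.lookup a m))"
  unfolding pd_poly_def using assms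
  by (intro sum.mono_neutral_left) (auto simp: in_keys_iff)

lemma pd_poly_add: "pd_poly v (a + b) = pd_poly v a + pd_poly v b"
proof -
  define S where "S = Poly_Mapping.keys a \<union> Poly_Mapping.keys b"
  have "finite S" "Poly_Mapping.keys a \<subseteq> S" "Poly_Mapping.keys b \<subseteq> S" "Poly_Mapping.keys (a + b) \<subseteq> S"
    using keys_add[of a b] by (auto simp: S_def)
  then show ?thesis
    by (simp add: pd_poly_superset[of S] lookup_add ring_distribs single_add sum.distrib)
qed

lemma pd_poly_0: "pd_poly v 0 = 0"
  by (simp add: pd_poly_def)

lemma pd_poly_sum: "pd_poly v (sum f A) = (\<Sum>i\<in>A. pd_poly v (f i))"
  by (induction A rule: infinite_finite_induct) (simp_all add: pd_poly_add pd_poly_0)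

lemma pd_poly_single:
  "pd_poly v (Poly_Mapping.single m c) =
     Poly_Mapping.single (m - Poly_Mapping.single v 1) (of_nat (Poly_Mapping.lookup m v) * c)"
  by (subst pd_poly_superset[of "{m}"]) auto

lemma mpol_sum_single: "(\<Sum>m\<in>Poly_Mapping.keys a. Poly_Mapping.single m (Poly_Mapping.lookup a m)) = (a :: mpol)"
  by (rule poly_mapping_eqI) (auto simp: lookup_sum lookup_single when_def in_keys_iff)

lemma pd_poly_mult_single:
  "pd_poly v (Poly_Mapping.single m c * Poly_Mapping.single n d) =
     pd_poly v (Poly_Mapping.single m c) * Poly_Mapping.single n d
     + Poly_Mapping.single m c * pd_poly v (Poly_Mapping.single n d)"
proof -
  let ?e = "Poly_Mapping.single v (1::nat)"
  let ?k = "m + n - ?e"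
  have 1: "Poly_Mapping.single (m - ?e + n) (of_nat (Poly_Mapping.lookup m v) * c * d) =
           Poly_Mapping.single ?k (of_nat (Poly_Mapping.lookup m v) * c * d)"
  proof (cases "Poly_Mapping.lookup m v = 0")
    case False
    then have "m - ?e + n = ?k"
      by (intro poly_mapping_eqI) (auto simp: lookup_add lookup_minus lookup_single when_def)
    then show ?thesis by simp
  qed simp
  have 2: "Poly_Mapping.single (m + (n - ?e)) (c * (of_nat (Poly_Mapping.lookup n v) * d)) =
           Poly_Mapping.single ?k (c * (of_nat (Poly_Mapping.lookup n v) * d))"
  proof (cases "Poly_Mapping.lookup n v = 0")
    case False
    then have "m + (n - ?e) = ?k"
      by (intro poly_mapping_eqI) (auto simp: lookup_add lookup_minus lookup_single when_def)
    then show ?thesis by simp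
  qed simp
  show ?thesis
    unfolding pd_poly_single mult_single 1 2 single_add[symmetric] lookup_add
    by (simp add: algebra_simps)
qed

lemma pd_poly_mult: "pd_poly v (a * b) = pd_poly v a * b + a * pd_poly v b"
proof -
  let ?f = "\<lambda>m. Poly_Mapping.single m (Poly_Mapping.lookup a m)"
  let ?g = "\<lambda>m. Poly_Mapping.single m (Poly_Mapping.lookup b m)"
  have "pd_poly v (sum ?f (Poly_Mapping.keys a) * sum ?g (Poly_Mapping.keys b)) =
          pd_poly v (sum ?f (Poly_Mapping.keys a)) * sum ?g (Poly_Mapping.keys b) + sum ?f (Poly_Mapping.keys a) * pd_poly v (sum ?g (Poly_Mapping.keys b))"
    by (simp only: sum_product pd_poly_sum pd_poly_mult_single sum.distrib)
  then show ?thesis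
    by (simp only: mpol_sum_single)
qed

lemma pd_Fract:
  assumes "b \<noteq> 0"
  shows "pd v (Fract a b) = Fract (pd_poly v a * b - a * pd_poly v b) (b * b)"
  unfolding pd_def
proof (rule the_equality)
  fix g
  assume "\<exists>a' b'. b' \<noteq> 0 \<and> Fract a b = Fract a' b' \<and>
              g = Fract (pd_poly v a' * b' - a' * pd_poly v b') (b' * b')"
  then obtain a' b' where b': "b' \<noteq> 0" and eq: "Fract a b = Fract a' b'"
    and g: "g = Fract (pd_poly v a' * b' - a' * pd_poly v b') (b' * b')" by blast
  have e: "a * b' = a' * b"
    using eq assms b' by (simp add: eq_fract)
  have d: "pd_poly v a * b' + a * pd_poly v b' = pd_poly v a' * b + a' * pd_poly v b"
    using arg_cong[OF e, of "pd_poly v"] by (simp add: pd_poly_mult)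
  have "(pd_poly v a' * b' - a' * pd_poly v b') * (b * b) - (pd_poly v a * b - a * pd_poly v b) * (b' * b') =
        b * b' * ((pd_poly v a' * b + a' * pd_poly v b) - (pd_poly v a * b' + a * pd_poly v b'))
        + (a * b' - a' * b) * (b' * pd_poly v b + b * pd_poly v b')"
    by (simp add: algebra_simps)
  also have "\<dots> = 0" by (simp add: d e)
  finally show "g = Fract (pd_poly v a * b - a * pd_poly v b) (b * b)"
    using assms b' by (simp add: g eq_fract)
qed (use assms in blast)

lemma pd_indet: "pd u (indet v) = (if u = v then 1 else 0)"
proof -
  have "pd_poly u 1 = 0"
    using pd_poly_single[of u 0 1] by simp
  then show ?thesis
    by (simp add: indet_def pd_Fract pd_poly_single lookup_single One_fract_def Zero_fract_def)
qed


section \<open>Substitution\<close>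

definition ev :: "(var \<Rightarrow> ratfun) \<Rightarrow> mpol \<Rightarrow> ratfun" where
  "ev \<sigma> a = (\<Sum>m\<in>Poly_Mapping.keys a. cst (Poly_Mapping.lookup a m) * (\<Prod>v\<in>UNIV. \<sigma> v ^ Poly_Mapping.lookup m v))"

(* Substitution into a rational function, through any representation as a fraction whose
   denominator does not vanish under the substitution. *)
definition substitute :: "(var \<Rightarrow> ratfun) \<Rightarrow> ratfun \<Rightarrow> ratfun" where
  "substitute \<sigma> f = (THE g. \<exists>a b. ev \<sigma> b \<noteq> 0 \<and> f = Fract a b \<and> g = ev \<sigma> a / ev \<sigma> b)"

lemma cst_0 [simp]: "cst 0 = 0" and cst_1 [simp]: "cst 1 = 1"
  by (simp_all add: cst_def Zero_fract_def One_fract_def)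

lemma cst_add: "cst (c + d) = cst c + cst d"
  by (simp add: cst_def single_add)

lemma cst_mult: "cst (c * d) = cst c * cst d"
  by (simp add: cst_def mult_single)

lemma ev_superset:
  assumes "finite S" "Poly_Mapping.keys a \<subseteq> S"
  shows "ev \<sigma> a = (\<Sum>m\<in>S. cst (Poly_Mapping.lookup a m) * (\<Prod>v\<in>UNIV. \<sigma> v ^ Poly_Mapping.lookup m v))"
  unfolding ev_def using assms
  by (intro sum.mono_neutral_left) (auto simp: in_keys_iff)

lemma ev_0 [simp]: "ev \<sigma> 0 = 0"
  by (simp add: ev_def)

lemma ev_add: "ev \<sigma> (a + b) = ev \<sigma> a + ev \<sigma> b"
proof -
  define S where "S = Poly_Mapping.keys a \<union> Poly_Mapping.keys b"
  have "finite S" "Poly_Mapping.keys a \<subseteq> S" "Poly_Mapping.keys b \<subseteq> S" "Poly_Mapping.keys (a + b) \<subseteq> S"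
    using keys_add[of a b] by (auto simp: S_def)
  then show ?thesis
    by (simp add: ev_superset[of S] lookup_add cst_add ring_distribs sum.distrib)
qed

lemma ev_sum: "ev \<sigma> (sum f A) = (\<Sum>i\<in>A. ev \<sigma> (f i))"
  by (induction A rule: infinite_finite_induct) (simp_all add: ev_add)

lemma ev_single:
  "ev \<sigma> (Poly_Mapping.single m c) = cst c * (\<Prod>v\<in>UNIV. \<sigma> v ^ Poly_Mapping.lookup m v)"
  by (subst ev_superset[of "{m}"]) auto

lemma ev_mult_single:
  "ev \<sigma> (Poly_Mapping.single m c * Poly_Mapping.single n d) =
     ev \<sigma> (Poly_Mapping.single m c) * ev \<sigma> (Poly_Mapping.single n d)"
  by (simp add: mult_single ev_single cst_mult lookup_add power_add prod.distrib ac_simps)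

lemma ev_mult: "ev \<sigma> (a * b) = ev \<sigma> a * ev \<sigma> b"
proof -
  let ?f = "\<lambda>m. Poly_Mapping.single m (Poly_Mapping.lookup a m)"
  let ?g = "\<lambda>m. Poly_Mapping.single m (Poly_Mapping.lookup b m)"
  have "ev \<sigma> (sum ?f (Poly_Mapping.keys a) * sum ?g (Poly_Mapping.keys b)) = ev \<sigma> (sum ?f (Poly_Mapping.keys a)) * ev \<sigma> (sum ?g (Poly_Mapping.keys b))"
    by (simp only: sum_product ev_sum ev_mult_single)
  then show ?thesis
    by (simp only: mpol_sum_single)
qed

lemma substitute_Fract:
  assumes "ev \<sigma> b \<noteq> 0"
  shows "substitute \<sigma> (Fract a b) = ev \<sigma> a / ev \<sigma> b"
  unfolding substitute_def
proof (rule the_equality)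
  fix g
  assume "\<exists>a' b'. ev \<sigma> b' \<noteq> 0 \<and> Fract a b = Fract a' b' \<and> g = ev \<sigma> a' / ev \<sigma> b'"
  then obtain a' b' where b': "ev \<sigma> b' \<noteq> 0" and eq: "Fract a b = Fract a' b'"
    and g: "g = ev \<sigma> a' / ev \<sigma> b'" by blast
  have "b \<noteq> 0" "b' \<noteq> 0" using assms b' by auto
  then have "a * b' = a' * b" using eq by (simp add: eq_fract)
  then have "ev \<sigma> a * ev \<sigma> b' = ev \<sigma> a' * ev \<sigma> b" by (metis ev_mult)
  then show "g = ev \<sigma> a / ev \<sigma> b"
    using assms b' by (simp add: g field_simps)
qed (use assms in blast)

lemma ev_1 [simp]: "ev \<sigma> 1 = 1"
  using ev_single[of \<sigma> 0 1] by simp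

lemma substitute_indet: "substitute \<sigma> (indet v) = \<sigma> v"
proof -
  have "(\<Prod>u\<in>UNIV. \<sigma> u ^ Poly_Mapping.lookup (Poly_Mapping.single v 1) u) =
        (\<Prod>u\<in>UNIV. if u = v then \<sigma> u else 1)"
    by (intro prod.cong) (auto simp: lookup_single)
  then show ?thesis
    by (simp add: indet_def substitute_Fract ev_single)
qed


section \<open>The Hamiltonian system\<close>

definition hamiltonian ::
  "'a::field \<Rightarrow> 'a \<Rightarrow> 'a \<Rightarrow> 'a \<Rightarrow> 'a \<Rightarrow> 'a \<Rightarrow> 'a \<Rightarrow> 'a \<Rightarrow> 'a \<Rightarrow> 'a \<Rightarrow> 'a" where
  "hamiltonian x y z w q p t \<alpha>\<^sub>1 \<alpha>\<^sub>2 \<alpha>\<^sub>3 =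
     1 / (4 * t) * y ^ 3 + 3 / 2 * y ^ 2 + (3 * \<alpha>\<^sub>3 - 1) / t * x * y
     + 3 / (4 * t) * z ^ 2 * w ^ 2 + 3 / 2 * z ^ 2 * w
     + (3 * \<alpha>\<^sub>1 + 3 * \<alpha>\<^sub>2 - 2) / (2 * t) * z * w + 3 / 2 * \<alpha>\<^sub>1 * z
     - 4 / t * p ^ 3 - 6 * p ^ 2 - (3 * \<alpha>\<^sub>1 + 3 * \<alpha>\<^sub>2 + 3 * \<alpha>\<^sub>3 - 2) / t * q * p - 6 * t * p
     + 3 / (4 * t) * \<alpha>\<^sub>1 * (8 * x * p + 2 * z * p + y * z) + 6 / t * \<alpha>\<^sub>2 * x * p
     + 3 / (2 * t) * \<alpha>\<^sub>3 * (4 * x * p - y * q)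
     + 3 / (4 * t) * (8 * x * y * q * p - 4 * z * w * q * p + 8 * x * z * w * p
         - 8 * x ^ 2 * y * p + 2 * z ^ 2 * w * p + y * z ^ 2 * w
         - 2 * y * q ^ 2 * p + 8 * w ^ 2 * p - 4 * y * p ^ 2 + 4 * y * w ^ 2
         + 4 * y ^ 2 * w + 8 * y * w * p - 8 * x * p + 8 * t * y * w)"

definition Ham :: ratfun where
  "Ham = hamiltonian (indet VX) (indet VY) (indet VZ) (indet VW) (indet VQ) (indet VP) (indet VT)
         (indet VA1) (indet VA2) (indet VA3)"

fun flow :: "var \<Rightarrow> ratfun" where
  "flow VX = pd VY Ham"
| "flow VY = - pd VX Ham"
| "flow VZ = pd VW Ham"
| "flow VW = - pd VZ Ham"
| "flow VQ = pd VP Ham"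
| "flow VP = - pd VQ Ham"
| "flow VT = 1"
| "flow VA1 = 0"
| "flow VA2 = 0"
| "flow VA3 = 0"

definition ddt :: "ratfun \<Rightarrow> ratfun" where
  "ddt f = (\<Sum>v\<in>UNIV. flow v * pd v f)"

lemma ddt_indet: "ddt (indet v) = flow v"
proof -
  have "ddt (indet v) = (\<Sum>u\<in>UNIV. if u = v then flow u else 0)"
    unfolding ddt_def by (intro sum.cong) (auto simp: pd_indet)
  then show ?thesis by simp
qed


section \<open>Baecklund transformations\<close>

definition field_aut :: "(ratfun \<Rightarrow> ratfun) \<Rightarrow> bool" where
  "field_aut \<phi> \<longleftrightarrow> bij \<phi> \<and> (\<forall>f g. \<phi> (f + g) = \<phi> f + \<phi> g) \<and> (\<forall>f g. \<phi> (f * g) = \<phi> f * \<phi> g)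
     \<and> (\<forall>c. \<phi> (cst c) = cst c)"

definition baecklund :: "(ratfun \<Rightarrow> ratfun) \<Rightarrow> bool" where
  "baecklund \<phi> \<longleftrightarrow> field_aut \<phi> \<and> (\<forall>f. \<phi> (ddt f) = ddt (\<phi> f))"

definition baecklund_group :: "(ratfun \<Rightarrow> ratfun) monoid" where
  "baecklund_group = BijGroup UNIV \<lparr>carrier := {\<phi>. baecklund \<phi>}\<rparr>"

datatype gen = S0 | S1 | S2 | S3

fun image_list :: "gen \<Rightarrow> 'a::field \<Rightarrow> 'a \<Rightarrow> 'a \<Rightarrow> 'a \<Rightarrow> 'a \<Rightarrow> 'a \<Rightarrow> 'a \<Rightarrow> 'a \<Rightarrow> 'a \<Rightarrow> 'a \<Rightarrow> 'a \<Rightarrow> 'a list"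
where
  "image_list S0 x y z w q p t \<alpha>\<^sub>0 \<alpha>\<^sub>1 \<alpha>\<^sub>2 \<alpha>\<^sub>3 =
     [x + \<alpha>\<^sub>0 / (y + z ^ 2 / 4), y, z, w - \<alpha>\<^sub>0 * z / (2 * (y + z ^ 2 / 4)), q, p, t,
      - \<alpha>\<^sub>0, \<alpha>\<^sub>1 + 2 * \<alpha>\<^sub>0, \<alpha>\<^sub>2, \<alpha>\<^sub>3]"
| "image_list S1 x y z w q p t \<alpha>\<^sub>0 \<alpha>\<^sub>1 \<alpha>\<^sub>2 \<alpha>\<^sub>3 =
     [x, y, z + \<alpha>\<^sub>1 / w, w, q, p, t,
      \<alpha>\<^sub>0 + \<alpha>\<^sub>1, - \<alpha>\<^sub>1, \<alpha>\<^sub>2 + \<alpha>\<^sub>1, \<alpha>\<^sub>3]"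
| "image_list S2 x y z w q p t \<alpha>\<^sub>0 \<alpha>\<^sub>1 \<alpha>\<^sub>2 \<alpha>\<^sub>3 =
     (let f\<^sub>2 = w + p + y / 2 + x * z / 2 - z * q / 4 + t in
     [x + (\<alpha>\<^sub>2 / 2) / f\<^sub>2,
      y - (\<alpha>\<^sub>2 * z / 2) / f\<^sub>2 - (\<alpha>\<^sub>2 ^ 2 / 4) / f\<^sub>2 ^ 2,
      z + \<alpha>\<^sub>2 / f\<^sub>2,
      w + (\<alpha>\<^sub>2 * (q - 2 * x) / 4) / f\<^sub>2,
      q + \<alpha>\<^sub>2 / f\<^sub>2,
      p + (\<alpha>\<^sub>2 * z / 4) / f\<^sub>2 + (\<alpha>\<^sub>2 ^ 2 / 8) / f\<^sub>2 ^ 2, t,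
      \<alpha>\<^sub>0, \<alpha>\<^sub>1 + \<alpha>\<^sub>2, - \<alpha>\<^sub>2, \<alpha>\<^sub>3 + \<alpha>\<^sub>2])"
| "image_list S3 x y z w q p t \<alpha>\<^sub>0 \<alpha>\<^sub>1 \<alpha>\<^sub>2 \<alpha>\<^sub>3 =
     [x, y, z, w, q + \<alpha>\<^sub>3 / p, p, t,
      \<alpha>\<^sub>0, \<alpha>\<^sub>1, \<alpha>\<^sub>2 + 2 * \<alpha>\<^sub>3, - \<alpha>\<^sub>3]"

definition images :: "gen \<Rightarrow> ratfun list" where
  "images i = image_list i (indet VX) (indet VY) (indet VZ) (indet VW) (indet VQ) (indet VP) (indet VT)
                alpha0 (indet VA1) (indet VA2) (indet VA3)"

definition bt :: "gen \<Rightarrow> ratfun \<Rightarrow> ratfun" where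
  "bt i = substitute (\<lambda>v. images i ! position v)"

lemma bij_imp_Bij: "bij \<phi> \<Longrightarrow> \<phi> \<in> Bij UNIV"
  by (simp add: Bij_def)

lemma baecklund_mult: "baecklund \<phi> \<Longrightarrow> baecklund \<psi> \<Longrightarrow> \<phi> \<otimes>\<^bsub>baecklund_group\<^esub> \<psi> = \<phi> \<circ> \<psi>"
  by (auto simp: baecklund_group_def BijGroup_def bij_imp_Bij baecklund_def field_aut_def
      compose_def)

lemma group_baecklund_group: "group baecklund_group"
  unfolding baecklund_group_def
proof (rule subgroup.subgroup_is_group[OF _ group_BijGroup], rule group.subgroupI[OF group_BijGroup])
  show "{\<phi>. baecklund \<phi>} \<subseteq> carrier (BijGroup UNIV)"
    by (auto simp: BijGroup_def bij_imp_Bij baecklund_def field_aut_def)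
  have "baecklund id" by (simp add: baecklund_def field_aut_def)
  then show "{\<phi>. baecklund \<phi>} \<noteq> {}" by blast
next
  fix \<phi> assume "\<phi> \<in> {\<phi>. baecklund \<phi>}"
  then have \<phi>: "baecklund \<phi>" by simp
  then have b: "bij \<phi>" by (simp add: baecklund_def field_aut_def)
  have inv: "inv\<^bsub>BijGroup UNIV\<^esub> \<phi> = inv_into UNIV \<phi>"
    using inv_BijGroup[OF bij_imp_Bij[OF b]] by (simp add: restrict_def)
  let ?\<psi> = "inv_into UNIV \<phi>"
  have i: "?\<psi> f = g \<longleftrightarrow> f = \<phi> g" for f g
    using b by (metis bij_inv_eq_iff)
  have r: "\<phi> (?\<psi> f) = f" for f
    using i[of f "?\<psi> f"] by simp
  have "?\<psi> (f + g) = ?\<psi> f + ?\<psi> g" "?\<psi> (f * g) = ?\<psi> f * ?\<psi> g" "?\<psi> (cst c) = cst c"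
    "?\<psi> (ddt f) = ddt (?\<psi> f)" for f g c
    using \<phi> unfolding i by (simp_all add: baecklund_def field_aut_def r)
  then have "baecklund ?\<psi>"
    using bij_imp_bij_inv[OF b] by (simp add: baecklund_def field_aut_def)
  then show "inv\<^bsub>BijGroup UNIV\<^esub> \<phi> \<in> {\<phi>. baecklund \<phi>}"
    by (simp add: inv)
next
  fix \<phi> \<psi> assume "\<phi> \<in> {\<phi>. baecklund \<phi>}" "\<psi> \<in> {\<phi>. baecklund \<phi>}"
  then have "\<phi> \<otimes>\<^bsub>BijGroup UNIV\<^esub> \<psi> = \<phi> \<circ> \<psi>" "baecklund \<phi>" "baecklund \<psi>"
    using baecklund_mult[of \<phi> \<psi>] by (auto simp: baecklund_group_def)
  then show "\<phi> \<otimes>\<^bsub>BijGroup UNIV\<^esub> \<psi> \<in> {\<phi>. baecklund \<phi>}"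
    by (auto simp: baecklund_def field_aut_def bij_comp)
qed


section \<open>The affine Weyl group by generators and relations\<close>

(* A letter (g, True) stands for the generator g and (g, False) for its formal inverse. *)
type_synonym 'g word = "('g \<times> bool) list"

inductive word_eq :: "'g word set \<Rightarrow> 'g word \<Rightarrow> 'g word \<Rightarrow> bool" for R where
  refl: "word_eq R u u"
| sym: "word_eq R u v \<Longrightarrow> word_eq R v u"
| trans: "word_eq R u v \<Longrightarrow> word_eq R v w \<Longrightarrow> word_eq R u w"
| append: "word_eq R u v \<Longrightarrow> word_eq R u' v' \<Longrightarrow> word_eq R (u @ u') (v @ v')"
| cancel: "word_eq R [(g, b), (g, \<not> b)] []"
| relator: "r \<in> R \<Longrightarrow> word_eq R r []"

definition word_class :: "'g word set \<Rightarrow> 'g word \<Rightarrow> 'g word set" where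
  "word_class R u = {v. word_eq R u v}"

(* The group presented by all elements of the type 'g as generators and by the relators R. *)
definition presented_group :: "'g word set \<Rightarrow> 'g word set monoid" where
  "presented_group R =
     \<lparr>carrier = range (word_class R),
      monoid.mult = (\<lambda>A B. \<Union>u\<in>A. \<Union>v\<in>B. word_class R (u @ v)),
      one = word_class R []\<rparr>"

definition coxeter_relator :: "'g \<Rightarrow> 'g \<Rightarrow> nat \<Rightarrow> 'g word" where
  "coxeter_relator i j n = concat (replicate n [(i, True), (j, True)])"

definition D42_relators :: "gen word set" where
  "D42_relators = range (\<lambda>i. [(i, True), (i, True)]) \<union>
     {coxeter_relator S0 S1 4, coxeter_relator S2 S3 4, coxeter_relator S1 S2 3,
      coxeter_relator S0 S2 2, coxeter_relator S0 S3 2, coxeter_relator S1 S3 2}"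

definition affine_Weyl_D42 :: "gen word set monoid" where
  "affine_Weyl_D42 = presented_group D42_relators"

definition simple_reflection :: "gen \<Rightarrow> gen word set" where
  "simple_reflection i = word_class D42_relators [(i, True)]"

lemma word_class_eq_iff: "word_class R u = word_class R v \<longleftrightarrow> word_eq R u v"
proof
  assume "word_class R u = word_class R v"
  then have "v \<in> word_class R u"
    by (simp add: word_class_def word_eq.refl)
  then show "word_eq R u v" by (simp add: word_class_def)
next
  assume uv: "word_eq R u v"
  have "word_eq R u w \<longleftrightarrow> word_eq R v w" for w
    using word_eq.trans[OF uv] word_eq.trans[OF word_eq.sym[OF uv]] by blast
  then show "word_class R u = word_class R v" by (simp add: word_class_def)
qed

lemma presented_group_mult:
  "word_class R u \<otimes>\<^bsub>presented_group R\<^esub> word_class R v = word_class R (u @ v)"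
proof -
  have "word_class R (u' @ v') = word_class R (u @ v)"
    if "u' \<in> word_class R u" "v' \<in> word_class R v" for u' v'
    using that word_eq.sym[OF word_eq.append, of R u u' v v']
    by (simp add: word_class_eq_iff) (simp add: word_class_def)
  then have "(\<Union>u'\<in>word_class R u. \<Union>v'\<in>word_class R v. word_class R (u' @ v')) =
      (\<Union>u'\<in>word_class R u. \<Union>v'\<in>word_class R v. word_class R (u @ v))"
    by simp
  moreover have "word_class R u \<noteq> {}" "word_class R v \<noteq> {}"
    using word_eq.refl[of R] by (auto simp: word_class_def)
  ultimately show ?thesis
    by (simp add: presented_group_def)
qed

lemma word_eq_inverse: "word_eq R (map (\<lambda>(g, b). (g, \<not> b)) (rev u) @ u) []"
proof (induction u)
  case Nil
  show ?case by (simp add: word_eq.refl)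
next
  case (Cons a u)
  obtain g b where a: "a = (g, b)" by force
  let ?v = "map (\<lambda>(g, b). (g, \<not> b)) (rev u)"
  have "word_eq R ([(g, \<not> b), (g, b)] @ u) ([] @ u)"
    using word_eq.cancel[of R g "\<not> b"] by (intro word_eq.append word_eq.refl) simp
  then have "word_eq R (?v @ [(g, \<not> b), (g, b)] @ u) (?v @ u)"
    by (intro word_eq.append word_eq.refl) simp
  then show ?case
    using Cons.IH by (auto simp: a intro: word_eq.trans)
qed

lemma group_presented_group: "group (presented_group R)"
proof (rule groupI)
  fix A assume "A \<in> carrier (presented_group R)"
  then obtain u where A: "A = word_class R u" by (auto simp: presented_group_def)
  have "word_class R (map (\<lambda>(g, b). (g, \<not> b)) (rev u)) \<otimes>\<^bsub>presented_group R\<^esub> A = word_class R []"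
    by (simp add: A presented_group_mult word_class_eq_iff word_eq_inverse)
  then show "\<exists>B\<in>carrier (presented_group R). B \<otimes>\<^bsub>presented_group R\<^esub> A = \<one>\<^bsub>presented_group R\<^esub>"
    by (auto simp: presented_group_def)
next
  fix A assume "A \<in> carrier (presented_group R)"
  then obtain u where A: "A = word_class R u" by (auto simp: presented_group_def)
  have one: "\<one>\<^bsub>presented_group R\<^esub> = word_class R []" by (simp add: presented_group_def)
  show "\<one>\<^bsub>presented_group R\<^esub> \<otimes>\<^bsub>presented_group R\<^esub> A = A"
    by (simp add: A one presented_group_mult)
next
  fix A B assume "A \<in> carrier (presented_group R)" "B \<in> carrier (presented_group R)"
  then obtain u v where "A = word_class R u" "B = word_class R v"
    by (auto simp: presented_group_def)
  then have "A \<otimes>\<^bsub>presented_group R\<^esub> B = word_class R (u @ v)"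
    by (simp add: presented_group_mult)
  then show "A \<otimes>\<^bsub>presented_group R\<^esub> B \<in> carrier (presented_group R)"
    by (simp add: presented_group_def)
next
  fix A B C
  assume "A \<in> carrier (presented_group R)" "B \<in> carrier (presented_group R)"
    "C \<in> carrier (presented_group R)"
  then obtain u v w where "A = word_class R u" "B = word_class R v" "C = word_class R w"
    by (auto simp: presented_group_def)
  then show "A \<otimes>\<^bsub>presented_group R\<^esub> B \<otimes>\<^bsub>presented_group R\<^esub> C =
             A \<otimes>\<^bsub>presented_group R\<^esub> (B \<otimes>\<^bsub>presented_group R\<^esub> C)"
    by (simp add: presented_group_mult)
qed (simp add: presented_group_def)

end

theory Submission
  imports Defs
begin

text \<open>
  \<^bold>\<open>Automorphisms.\<close> Let \<open>f\<^sub>i\<close> be the denominator that occurs in \<open>s\<^sub>i\<close>, that is \<open>y + z\<^sup>2/4\<close>, \<open>w\<close>,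
  \<open>f\<^sub>2\<close> or \<open>p\<close>, and let \<open>c\<^sub>i = \<alpha>\<^sub>i / f\<^sub>i\<close>. The images of all variables under \<open>s\<^sub>i\<close> are polynomials in
  the variables and \<open>c\<^sub>i\<close>, and \<open>s\<^sub>i\<close> fixes \<open>f\<^sub>i\<close> and negates \<open>\<alpha>\<^sub>i\<close>, hence negates \<open>c\<^sub>i\<close>. So applying the
  substitution twice gives back every variable. This alone forces the images to be algebraically
  independent, so the substitution is an involutive automorphism
  (lemmas \<open>involutive_substitution\<close> and \<open>bt_involutive_endo\<close>).

  \<^bold>\<open>Symmetry of the system.\<close> The hypersurface \<open>f\<^sub>i = 0\<close> is invariant under the flow when \<open>\<alpha>\<^sub>i = 0\<close>;
  quantitatively \<open>t f\<^sub>i' = A f\<^sub>i + B \<alpha>\<^sub>i\<close> with polynomials \<open>A\<close> and \<open>B\<close>. Therefore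
  \<open>t c\<^sub>i' = - c\<^sub>i (A + B c\<^sub>i)\<close> is a polynomial in \<open>c\<^sub>i\<close>. If \<open>\<alpha>\<^sub>i\<close> is now eliminated by \<open>\<alpha>\<^sub>i = c\<^sub>i f\<^sub>i\<close>, the
  assertion that \<open>s\<^sub>i\<close> commutes with \<open>t d/dt\<close> on a variable is an identity between polynomials.
  Both composites are derivations along \<open>s\<^sub>i\<close>, so agreement on the variables is enough
  (lemma \<open>bt_ddt\<close>).

  \<^bold>\<open>Relations.\<close> Two automorphisms agree if they agree on the variables. On a variable, an alternating
  product of \<open>s\<^sub>i\<close> and \<open>s\<^sub>j\<close> is a polynomial in successive images of \<open>c\<^sub>i\<close> and \<open>c\<^sub>j\<close>, and the relation
  follows from a few identities between these images. The pairs \<open>(0,1)\<close> and \<open>(3,2)\<close> are instances of the same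
  computation (lemma \<open>order_4_braid_identities\<close>).

  \<^bold>\<open>Faithfulness.\<close> Put \<open>e\<^sub>1 = \<alpha>\<^sub>1 + \<alpha>\<^sub>2 + \<alpha>\<^sub>3\<close>, \<open>e\<^sub>2 = \<alpha>\<^sub>2 + \<alpha>\<^sub>3\<close>, \<open>e\<^sub>3 = \<alpha>\<^sub>3\<close>. Then \<open>s\<^sub>0\<close> sends \<open>e\<^sub>1\<close> to
  \<open>2 - e\<^sub>1\<close>, \<open>s\<^sub>3\<close> sends \<open>e\<^sub>3\<close> to \<open>- e\<^sub>3\<close>, and \<open>s\<^sub>1\<close>, \<open>s\<^sub>2\<close> exchange neighbouring coordinates: the group
  of affine signed permutations, which is the wreath product of an infinite dihedral group with the
  symmetric group on three letters. Already in the presented group each word can be brought to the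
  form \<open>d\<^sub>1 d\<^sub>2 d\<^sub>3 \<sigma>\<close> with \<open>d\<^sub>i\<close> an alternating word in the two reflections of the coordinate \<open>e\<^sub>i\<close> and
  \<open>\<sigma>\<close> one of the six reduced words in \<open>s\<^sub>1, s\<^sub>2\<close> (lemma \<open>normal_word_exists\<close>), and such a word fixes
  all \<open>e\<^sub>i\<close> only if it is empty (lemma \<open>bts_normal_word_eq_id\<close>). So a word that acts as the identity
  is trivial in the Coxeter group, and the action is an isomorphism onto its image.
\<close>


section \<open>Rational functions as values of polynomials\<close>

text \<open>Characteristic zero makes all numerical denominators below invertible.\<close>

instance fract :: ("{idom, ring_char_0}") field_char_0
proof
  have "(of_nat n :: 'a fract) = Fract (of_nat n) 1" for n
    by (induction n) (simp_all add: One_fract_def Zero_fract_def)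
  then show "inj (of_nat :: nat \<Rightarrow> 'a fract)"
    by (auto simp: inj_def eq_fract)
qed

lemma Fract_eq_ev_indet: "Fract a 1 = ev indet a"
proof -
  have pow: "indet v ^ n = Fract (Poly_Mapping.single (Poly_Mapping.single v n) 1) 1" for v n
    by (induction n)
      (simp_all add: indet_def mult_single One_fract_def flip: single_add)
  have prod: "(\<Prod>v\<in>A. indet v ^ Poly_Mapping.lookup m v) =
      Fract (Poly_Mapping.single (\<Sum>v\<in>A. Poly_Mapping.single v (Poly_Mapping.lookup m v)) 1) 1"
    if "finite A" for A m
    using that by (induction A) (simp_all add: pow mult_single One_fract_def)
  have mon: "(\<Sum>v\<in>UNIV. Poly_Mapping.single v (Poly_Mapping.lookup m v)) = m" for m :: mono
    by (rule poly_mapping_eqI) (simp add: lookup_sum lookup_single when_def)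
  have single: "Fract (Poly_Mapping.single m c) 1 = ev indet (Poly_Mapping.single m c)" for m c
    by (simp add: ev_single prod mon cst_def mult_single)
  have Fract_add: "Fract a 1 + Fract b 1 = Fract (a + b) 1" for a b :: mpol
    by simp
  have sum: "Fract (sum f A) 1 = (\<Sum>i\<in>A. Fract (f i) 1)" for f :: "mono \<Rightarrow> mpol" and A
    by (induction A rule: infinite_finite_induct) (simp_all add: Zero_fract_def flip: Fract_add del: add_fract)
  show ?thesis
    by (subst (1 2) mpol_sum_single[symmetric]) (simp only: sum single ev_sum)
qed

lemma ratfun_cases:
  obtains a b where "b \<noteq> 0" "f = ev indet a / ev indet b" "f = Fract a b"
proof (cases f)
  case (Fract a b)
  then have "f = Fract a 1 / Fract b 1" by simp
  with Fract that show ?thesis unfolding Fract_eq_ev_indet by blast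
qed

lemma ev_indet_eq_0_iff: "ev indet a = 0 \<longleftrightarrow> a = 0"
  by (simp flip: Fract_eq_ev_indet add: Zero_fract_def eq_fract)

text \<open>
  Every rational function arises from indeterminates and constants by field operations. All
  uniqueness statements about maps on the field are proved with this induction.
\<close>

lemma ratfun_induct [case_names indet cst add mult divide]:
  assumes indet: "\<And>v. P (indet v)" and cst: "\<And>c. P (cst c)"
    and add: "\<And>f g. P f \<Longrightarrow> P g \<Longrightarrow> P (f + g)"
    and mult: "\<And>f g. P f \<Longrightarrow> P g \<Longrightarrow> P (f * g)"
    and divide: "\<And>f g. P f \<Longrightarrow> P g \<Longrightarrow> g \<noteq> 0 \<Longrightarrow> P (f / g)"
  shows "P f"
proof -
  have pow: "P (indet v ^ n)" for v n
    by (induction n) (use cst[of 1] in \<open>auto intro: mult indet\<close>)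
  have prod: "P (\<Prod>v\<in>A. indet v ^ Poly_Mapping.lookup m v)" for A m
    by (induction A rule: infinite_finite_induct) (use cst[of 1] in \<open>auto intro: mult pow\<close>)
  have sum: "P (\<Sum>m\<in>A. cst (c m) * (\<Prod>v\<in>UNIV. indet v ^ Poly_Mapping.lookup m v))" for A c
    by (induction A rule: infinite_finite_induct) (use cst[of 0] in \<open>auto intro: add mult prod cst\<close>)
  obtain a b where "b \<noteq> 0" "f = ev indet a / ev indet b" by (rule ratfun_cases)
  moreover have "P (ev indet a)" for a
    unfolding ev_def by (rule sum)
  ultimately show ?thesis by (simp add: divide ev_indet_eq_0_iff)
qed


section \<open>Endomorphisms and derivations of the field of rational functions\<close>

definition endo :: "(ratfun \<Rightarrow> ratfun) \<Rightarrow> bool" where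
  "endo \<phi> \<longleftrightarrow> (\<forall>f g. \<phi> (f + g) = \<phi> f + \<phi> g) \<and> (\<forall>f g. \<phi> (f * g) = \<phi> f * \<phi> g) \<and> (\<forall>c. \<phi> (cst c) = cst c)"

lemma cst_of_nat: "cst (of_nat n) = of_nat n"
  by (induction n) (simp_all add: cst_add)

lemma cst_numeral: "cst (numeral n) = numeral n"
  using cst_of_nat[of "numeral n"] by simp

lemma cst_minus: "cst (- c) = - cst c"
  using cst_add[of "- c" c] by (simp add: eq_neg_iff_add_eq_0)

locale endomorphism =
  fixes \<phi> :: "ratfun \<Rightarrow> ratfun"
  assumes endo: "endo \<phi>"
begin

lemma add: "\<phi> (f + g) = \<phi> f + \<phi> g" and mult: "\<phi> (f * g) = \<phi> f * \<phi> g"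
  and cst: "\<phi> (cst c) = cst c"
  using endo by (simp_all add: endo_def)

lemma zero: "\<phi> 0 = 0" and one: "\<phi> 1 = 1" and num: "\<phi> (numeral n) = numeral n"
  using cst[of 0] cst[of 1] cst[of "numeral n"] by (simp_all add: cst_numeral)

lemma uminus: "\<phi> (- f) = - \<phi> f"
  using add[of f "- f"] by (simp add: zero eq_neg_iff_add_eq_0 add.commute)

lemma diff: "\<phi> (f - g) = \<phi> f - \<phi> g"
  using add[of f "- g"] by (simp add: uminus)

lemma power: "\<phi> (f ^ n) = \<phi> f ^ n"
  by (induction n) (simp_all add: one mult)

lemma eq_0_iff: "\<phi> f = 0 \<longleftrightarrow> f = 0"
proof
  show "f = 0" if "\<phi> f = 0"
  proof (rule ccontr)
    assume "f \<noteq> 0"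
    then have "\<phi> f * \<phi> (1 / f) = 1" by (simp add: one flip: mult)
    with that show False by simp
  qed
qed (simp add: zero)

lemma divide: "\<phi> (f / g) = \<phi> f / \<phi> g"
proof (cases "g = 0")
  case False
  then have "\<phi> (f / g) * \<phi> g = \<phi> f" by (simp flip: mult)
  with False show ?thesis by (simp add: eq_divide_eq eq_0_iff)
qed (simp add: zero)

lemmas hom_simps = add mult cst zero one num uminus diff power divide

end

lemma endo_eqI:
  assumes "endo \<phi>" "endo \<psi>" "\<And>v. \<phi> (indet v) = \<psi> (indet v)"
  shows "\<phi> = \<psi>"
proof
  interpret \<phi>: endomorphism \<phi> by standard fact
  interpret \<psi>: endomorphism \<psi> by standard fact
  show "\<phi> f = \<psi> f" for f
    by (induction f rule: ratfun_induct) (simp_all add: assms \<phi>.hom_simps \<psi>.hom_simps)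
qed

lemma endo_comp: "endo \<phi> \<Longrightarrow> endo \<psi> \<Longrightarrow> endo (\<phi> \<circ> \<psi>)"
  by (simp add: endo_def)

lemma endo_id: "endo id"
  by (simp add: endo_def)

text \<open>
  If \<open>D\<close> is a derivation and \<open>\<phi>\<close> an endomorphism, then both \<open>\<phi> \<circ> D\<close> and \<open>D \<circ> \<phi>\<close> satisfy the Leibniz rule
  twisted by \<open>\<phi>\<close>; this is the common class in which they are compared.
\<close>

definition twisted_derivation :: "(ratfun \<Rightarrow> ratfun) \<Rightarrow> (ratfun \<Rightarrow> ratfun) \<Rightarrow> bool" where
  "twisted_derivation \<phi> D \<longleftrightarrow> (\<forall>f g. D (f + g) = D f + D g) \<and>
     (\<forall>f g. D (f * g) = D f * \<phi> g + \<phi> f * D g) \<and> (\<forall>c. D (cst c) = 0)"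

lemma twisted_derivation_eqI:
  assumes "endo \<phi>" "twisted_derivation \<phi> D" "twisted_derivation \<phi> E"
    and indet: "\<And>v. D (indet v) = E (indet v)"
  shows "D f = E f"
proof -
  interpret endomorphism \<phi> by standard fact
  have D: "D (f + g) = D f + D g" "D (f * g) = D f * \<phi> g + \<phi> f * D g" "D (cst c) = 0"
    and E: "E (f + g) = E f + E g" "E (f * g) = E f * \<phi> g + \<phi> f * E g" "E (cst c) = 0" for f g c
    using assms by (simp_all add: twisted_derivation_def)
  show ?thesis
  proof (induction f rule: ratfun_induct)
    case (divide f g)
    have "D (f / g) * \<phi> g + \<phi> (f / g) * D g = E (f / g) * \<phi> g + \<phi> (f / g) * E g"
      using divide.IH(1) \<open>g \<noteq> 0\<close> by (simp flip: D(2) E(2))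
    then show ?case
      using divide.IH(2) \<open>g \<noteq> 0\<close> by (simp add: eq_0_iff)
  qed (simp_all add: indet D E)
qed

locale derivation =
  fixes D :: "ratfun \<Rightarrow> ratfun"
  assumes deriv: "twisted_derivation id D"
begin

lemma add: "D (f + g) = D f + D g" and mult: "D (f * g) = D f * g + f * D g"
  and cst: "D (cst c) = 0"
  using deriv by (simp_all add: twisted_derivation_def)

lemma zero: "D 0 = 0" and one: "D 1 = 0" and num: "D (numeral n) = 0"
  using cst[of 0] cst[of 1] cst[of "numeral n"] by (simp_all add: cst_numeral)

lemma uminus: "D (- f) = - D f"
  using add[of f "- f"] by (simp add: zero eq_neg_iff_add_eq_0 add.commute)

lemma diff: "D (f - g) = D f - D g"
  using add[of f "- g"] by (simp add: uminus)

lemma power2: "D (f ^ 2) = 2 * f * D f"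
  by (simp add: mult power2_eq_square)

lemma power3: "D (f ^ 3) = 3 * f ^ 2 * D f"
  by (simp add: mult power3_eq_cube power2_eq_square algebra_simps)

lemma divide: "g \<noteq> 0 \<Longrightarrow> D (f / g) = (D f * g - f * D g) / g ^ 2"
proof -
  assume "g \<noteq> 0"
  then have "D f = D (f / g) * g + f / g * D g"
    using mult[of "f / g" g] by simp
  with \<open>g \<noteq> 0\<close> show ?thesis
    by (simp add: field_simps power2_eq_square)
qed

lemmas deriv_simps = add mult cst zero one num uminus diff power2 power3

end

lemma pd_derivation: "derivation (pd v)"
proof
  show "twisted_derivation id (pd v)"
    unfolding twisted_derivation_def
  proof (intro conjI allI)
    fix f g :: ratfun and c
    obtain a b where b: "b \<noteq> 0" "f = Fract a b" by (rule ratfun_cases)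
    obtain a' b' where b': "b' \<noteq> 0" "g = Fract a' b'" by (rule ratfun_cases)
    show "pd v (f + g) = pd v f + pd v g" "pd v (f * g) = pd v f * id g + id f * pd v g"
      using b(1) b'(1)
      by (simp_all add: b(2) b'(2) pd_Fract pd_poly_add pd_poly_mult eq_fract) (simp_all add: algebra_simps)
    show "pd v (cst c) = 0"
      using pd_poly_single[of v 0 c] pd_poly_single[of v 0 1]
      by (simp add: cst_def pd_Fract Zero_fract_def)
  qed
qed

global_interpretation pd: derivation "pd v" for v
  by (rule pd_derivation)

global_interpretation ddt: derivation ddt
proof
  show "twisted_derivation id ddt"
    by (simp add: twisted_derivation_def ddt_def pd.add pd.mult pd.cst sum.distrib
        sum_distrib_left sum_distrib_right algebra_simps)
qed


section \<open>Involutive substitutions\<close>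

text \<open>
  The domain on which substitution is meaningful before it is known that no nonzero denominator
  vanishes under it.
\<close>

definition regular :: "(var \<Rightarrow> ratfun) \<Rightarrow> ratfun \<Rightarrow> bool" where
  "regular \<sigma> f \<longleftrightarrow> (\<exists>a b. ev \<sigma> b \<noteq> 0 \<and> f = Fract a b)"

lemma ev_nonzero: "ev \<sigma> b \<noteq> 0 \<Longrightarrow> b \<noteq> 0"
  by auto

context
  fixes \<sigma> :: "var \<Rightarrow> ratfun"
begin

lemma regular_add_aux:
  assumes "regular \<sigma> f" "regular \<sigma> g"
  shows "regular \<sigma> (f + g) \<and> substitute \<sigma> (f + g) = substitute \<sigma> f + substitute \<sigma> g"
    and "regular \<sigma> (f * g) \<and> substitute \<sigma> (f * g) = substitute \<sigma> f * substitute \<sigma> g"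
proof -
  obtain a b where f: "ev \<sigma> b \<noteq> 0" "f = Fract a b" using assms by (auto simp: regular_def)
  obtain a' b' where g: "ev \<sigma> b' \<noteq> 0" "g = Fract a' b'" using assms by (auto simp: regular_def)
  have nz: "ev \<sigma> (b * b') \<noteq> 0" using f g by (simp add: ev_mult)
  have "f + g = Fract (a * b' + a' * b) (b * b')" "f * g = Fract (a * a') (b * b')"
    using f g by (auto dest!: ev_nonzero)
  note eq = this
  have "regular \<sigma> (f + g)" "regular \<sigma> (f * g)"
    using nz eq unfolding regular_def by blast+
  then show "regular \<sigma> (f + g) \<and> substitute \<sigma> (f + g) = substitute \<sigma> f + substitute \<sigma> g"
    "regular \<sigma> (f * g) \<and> substitute \<sigma> (f * g) = substitute \<sigma> f * substitute \<sigma> g"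
    unfolding eq using nz f g
    by (simp_all add: substitute_Fract ev_add ev_mult add_frac_eq)
qed

lemma regular_inverse_aux:
  assumes "regular \<sigma> f" "substitute \<sigma> f \<noteq> 0"
  shows "regular \<sigma> (1 / f) \<and> substitute \<sigma> (1 / f) = 1 / substitute \<sigma> f"
proof -
  obtain a b where f: "ev \<sigma> b \<noteq> 0" "f = Fract a b" using assms by (auto simp: regular_def)
  have nz: "ev \<sigma> a \<noteq> 0" using assms f by (auto simp: substitute_Fract)
  have "1 / f = Fract b a" using f by (simp add: One_fract_def)
  then show ?thesis
    using nz f unfolding regular_def by (auto simp: substitute_Fract)
qed

lemma regular_cst: "regular \<sigma> (cst c)" and substitute_cst: "substitute \<sigma> (cst c) = cst c"
proof -
  have "ev \<sigma> 1 \<noteq> 0" "cst c = Fract (Poly_Mapping.single 0 c) 1" by (simp_all add: cst_def)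
  then show "regular \<sigma> (cst c)" "substitute \<sigma> (cst c) = cst c"
    unfolding regular_def by (blast, simp add: substitute_Fract ev_single)
qed

lemma regular_indet: "regular \<sigma> (indet v)"
proof -
  have "ev \<sigma> 1 \<noteq> 0" by simp
  then show ?thesis unfolding regular_def indet_def by blast
qed

lemma regular_num: "regular \<sigma> (numeral n)" "regular \<sigma> 1" "regular \<sigma> 0" "regular \<sigma> (- 1)"
  using regular_cst[of "numeral n"] regular_cst[of 1] regular_cst[of 0] regular_cst[of "- 1"]
  by (simp_all add: cst_numeral cst_minus)

lemma substitute_num: "substitute \<sigma> (numeral n) = numeral n" "substitute \<sigma> 1 = 1"
  "substitute \<sigma> 0 = 0" "substitute \<sigma> (- 1) = - 1"
  using substitute_cst[of "numeral n"] substitute_cst[of 1] substitute_cst[of 0] substitute_cst[of "- 1"]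
  by (simp_all add: cst_numeral cst_minus)

lemma
  assumes f: "regular \<sigma> f" and g: "regular \<sigma> g"
  shows regular_add: "regular \<sigma> (f + g)"
    and substitute_add: "substitute \<sigma> (f + g) = substitute \<sigma> f + substitute \<sigma> g"
    and regular_mult: "regular \<sigma> (f * g)"
    and substitute_mult: "substitute \<sigma> (f * g) = substitute \<sigma> f * substitute \<sigma> g"
    and regular_diff: "regular \<sigma> (f - g)"
    and substitute_diff: "substitute \<sigma> (f - g) = substitute \<sigma> f - substitute \<sigma> g"
    and regular_uminus: "regular \<sigma> (- f)"
    and substitute_uminus: "substitute \<sigma> (- f) = - substitute \<sigma> f"
    and regular_divide: "substitute \<sigma> g \<noteq> 0 \<Longrightarrow> regular \<sigma> (f / g)"
    and substitute_divide: "substitute \<sigma> g \<noteq> 0 \<Longrightarrow> substitute \<sigma> (f / g) = substitute \<sigma> f / substitute \<sigma> g"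
proof -
  have m: "regular \<sigma> (- h) \<and> substitute \<sigma> (- h) = - substitute \<sigma> h" if "regular \<sigma> h" for h
    using regular_add_aux(2)[OF regular_num(4) that] by (simp add: substitute_num)
  show "regular \<sigma> (f + g)" "substitute \<sigma> (f + g) = substitute \<sigma> f + substitute \<sigma> g"
    "regular \<sigma> (f * g)" "substitute \<sigma> (f * g) = substitute \<sigma> f * substitute \<sigma> g"
    using regular_add_aux[OF f g] by simp_all
  show "regular \<sigma> (- f)" "substitute \<sigma> (- f) = - substitute \<sigma> f"
    using m[OF f] by simp_all
  show "regular \<sigma> (f - g)" "substitute \<sigma> (f - g) = substitute \<sigma> f - substitute \<sigma> g"
    using m[OF g] regular_add_aux(1)[OF f, of "- g"] by simp_all
  assume "substitute \<sigma> g \<noteq> 0"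
  then show "regular \<sigma> (f / g)" "substitute \<sigma> (f / g) = substitute \<sigma> f / substitute \<sigma> g"
    using regular_inverse_aux[OF g] regular_add_aux(2)[OF f, of "1 / g"] by simp_all
qed

lemma
  assumes f: "regular \<sigma> f"
  shows regular_power: "regular \<sigma> (f ^ n)"
    and substitute_power: "substitute \<sigma> (f ^ n) = substitute \<sigma> f ^ n"
proof -
  have "regular \<sigma> (f ^ n) \<and> substitute \<sigma> (f ^ n) = substitute \<sigma> f ^ n"
    by (induction n) (simp_all add: f regular_num substitute_num regular_mult substitute_mult)
  then show "regular \<sigma> (f ^ n)" "substitute \<sigma> (f ^ n) = substitute \<sigma> f ^ n" by simp_all
qed

lemma substitute_ev:
  assumes "\<And>v. regular \<sigma> (\<tau> v)"
  shows "regular \<sigma> (ev \<tau> a) \<and> substitute \<sigma> (ev \<tau> a) = ev (\<lambda>v. substitute \<sigma> (\<tau> v)) a"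
proof -
  have prod: "regular \<sigma> (\<Prod>v\<in>A. \<tau> v ^ e v) \<and>
      substitute \<sigma> (\<Prod>v\<in>A. \<tau> v ^ e v) = (\<Prod>v\<in>A. substitute \<sigma> (\<tau> v) ^ e v)" for A and e :: "var \<Rightarrow> nat"
    by (induction A rule: infinite_finite_induct)
      (simp_all add: regular_num substitute_num regular_mult substitute_mult regular_power
        substitute_power assms)
  have "regular \<sigma> (\<Sum>m\<in>A. cst (c m) * (\<Prod>v\<in>UNIV. \<tau> v ^ Poly_Mapping.lookup m v)) \<and>
      substitute \<sigma> (\<Sum>m\<in>A. cst (c m) * (\<Prod>v\<in>UNIV. \<tau> v ^ Poly_Mapping.lookup m v)) =
      (\<Sum>m\<in>A. cst (c m) * (\<Prod>v\<in>UNIV. substitute \<sigma> (\<tau> v) ^ Poly_Mapping.lookup m v))" for A c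
    by (induction A rule: infinite_finite_induct)
      (simp_all add: regular_num substitute_num regular_add substitute_add regular_mult
        substitute_mult regular_cst substitute_cst prod)
  then show ?thesis unfolding ev_def by blast
qed

text \<open>
  Suppose a nonzero polynomial \<open>a\<close> vanished at the images of the variables. These images are
  regular, so the substitution can be applied once more to the value \<open>0\<close>, and the result is \<open>a\<close>
  itself since the second application restores every variable. Hence no denominator ever vanishes and
  every rational function is regular.
\<close>

lemma involutive_substitution:
  assumes reg: "\<And>v. regular \<sigma> (\<sigma> v)" and inv: "\<And>v. substitute \<sigma> (\<sigma> v) = indet v"
  shows "endo (substitute \<sigma>)" and "substitute \<sigma> (substitute \<sigma> f) = f"
proof -
  have nz: "ev \<sigma> a \<noteq> 0" if "a \<noteq> 0" for a
  proof
    assume "ev \<sigma> a = 0"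
    then have "ev indet a = 0"
      using substitute_ev[of \<sigma> a] by (simp add: reg inv substitute_num)
    with that show False by (simp add: ev_indet_eq_0_iff)
  qed
  have "regular \<sigma> f" for f
    using nz by (metis ratfun_cases regular_def)
  then show e: "endo (substitute \<sigma>)"
    by (simp add: endo_def substitute_add substitute_mult substitute_cst)
  have "substitute \<sigma> \<circ> substitute \<sigma> = id"
    by (rule endo_eqI) (simp_all add: endo_comp endo_id e substitute_indet inv)
  then show "substitute \<sigma> (substitute \<sigma> f) = f"
    by (metis comp_apply id_apply)
qed

end


section \<open>The four transformations are involutive automorphisms\<close>

abbreviation vx :: ratfun where "vx \<equiv> indet VX"
abbreviation vy :: ratfun where "vy \<equiv> indet VY"
abbreviation vz :: ratfun where "vz \<equiv> indet VZ"
abbreviation vw :: ratfun where "vw \<equiv> indet VW"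
abbreviation vq :: ratfun where "vq \<equiv> indet VQ"
abbreviation vp :: ratfun where "vp \<equiv> indet VP"
abbreviation vt :: ratfun where "vt \<equiv> indet VT"
abbreviation va1 :: ratfun where "va1 \<equiv> indet VA1"
abbreviation va2 :: ratfun where "va2 \<equiv> indet VA2"
abbreviation va3 :: ratfun where "va3 \<equiv> indet VA3"

text \<open>
  The denominators of the transformations. In the language of reflection groups, \<open>wall i\<close> is the
  invariant divisor belonging to the simple root \<open>\<alpha>\<^sub>i\<close>.
\<close>

fun wall :: "gen \<Rightarrow> ratfun" where
  "wall S0 = vy + vz ^ 2 / 4"
| "wall S1 = vw"
| "wall S2 = vw + vp + vy / 2 + vx * vz / 2 - vz * vq / 4 + vt"
| "wall S3 = vp"

fun simple_root :: "gen \<Rightarrow> ratfun" where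
  "simple_root S0 = alpha0"
| "simple_root S1 = va1"
| "simple_root S2 = va2"
| "simple_root S3 = va3"

definition slope :: "gen \<Rightarrow> ratfun" where
  "slope i = simple_root i / wall i"

text \<open>For \<open>g = 0\<close> both sides vanish, so the rule can be used for rewriting without a side condition on \<open>g\<close>.\<close>

lemma (in derivation) divide_const: "D g = 0 \<Longrightarrow> D (f / g) = D f / g"
  by (cases "g = 0") (simp_all add: zero divide power2_eq_square)

lemma indet_nonzero: "indet v \<noteq> 0"
  using pd_indet[of v v] by (auto simp: pd.zero)

lemma wall_nonzero: "wall i \<noteq> 0"
proof
  assume "wall i = 0"
  then have "pd v (wall i) = 0" for v
    by (simp add: pd.zero)
  from this[of VY] this[of VW] this[of VP] show False
    by (cases i) (simp_all add: pd.deriv_simps pd.divide_const pd_indet)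
qed

lemma simple_root_eq: "simple_root i = slope i * wall i"
  by (simp add: slope_def wall_nonzero)

lemma bt_indet: "bt i (indet v) = images i ! position v"
  by (simp add: bt_def substitute_indet)

text \<open>
  Written with the slopes, the images of the variables are polynomials. The slopes are kept as
  opaque symbols in all computations that follow.
\<close>

lemma bt_S0:
  "bt S0 vx = vx + slope S0" "bt S0 vy = vy" "bt S0 vz = vz" "bt S0 vw = vw - slope S0 * vz / 2"
  "bt S0 vq = vq" "bt S0 vp = vp" "bt S0 vt = vt"
  "bt S0 va1 = va1 + 2 * alpha0" "bt S0 va2 = va2" "bt S0 va3 = va3"
  by (simp_all add: bt_indet images_def slope_def)

lemma bt_S1:
  "bt S1 vx = vx" "bt S1 vy = vy" "bt S1 vz = vz + slope S1" "bt S1 vw = vw"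
  "bt S1 vq = vq" "bt S1 vp = vp" "bt S1 vt = vt"
  "bt S1 va1 = - va1" "bt S1 va2 = va2 + va1" "bt S1 va3 = va3"
  by (simp_all add: bt_indet images_def slope_def)

lemma bt_S2:
  "bt S2 vx = vx + slope S2 / 2" "bt S2 vy = vy - slope S2 * vz / 2 - slope S2 ^ 2 / 4"
  "bt S2 vz = vz + slope S2" "bt S2 vw = vw + slope S2 * (vq - 2 * vx) / 4"
  "bt S2 vq = vq + slope S2" "bt S2 vp = vp + slope S2 * vz / 4 + slope S2 ^ 2 / 8" "bt S2 vt = vt"
  "bt S2 va1 = va1 + va2" "bt S2 va2 = - va2" "bt S2 va3 = va3 + va2"
  by (simp_all add: bt_indet images_def slope_def Let_def power_divide ac_simps)

lemma bt_S3:
  "bt S3 vx = vx" "bt S3 vy = vy" "bt S3 vz = vz" "bt S3 vw = vw"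
  "bt S3 vq = vq + slope S3" "bt S3 vp = vp" "bt S3 vt = vt"
  "bt S3 va1 = va1" "bt S3 va2 = va2 + 2 * va3" "bt S3 va3 = - va3"
  by (simp_all add: bt_indet images_def slope_def)

lemmas bt_simps = bt_S0 bt_S1 bt_S2 bt_S3

lemmas regular_simps = regular_add regular_mult regular_diff regular_uminus regular_divide
  regular_power regular_num regular_indet
lemmas substitute_simps = substitute_add substitute_mult substitute_diff substitute_uminus
  substitute_divide substitute_power substitute_num

text \<open>
  The wall is fixed and the simple root is negated, so the slope is negated; inserting this into the
  images shows that the second application undoes the first.
\<close>

lemma bt_involutive_endo: "endo (bt i) \<and> bt i (bt i f) = f"
proof -
  define \<sigma> where "\<sigma> = (\<lambda>v. images i ! position v)"
  have bt: "bt i = substitute \<sigma>" by (simp add: \<sigma>_def bt_def)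
  note s = regular_simps substitute_simps
  have ind: "substitute \<sigma> (indet v) = bt i (indet v)" for v by (simp add: bt)
  have \<sigma>: "\<sigma> v = bt i (indet v)" for v by (simp add: bt substitute_indet)
  have nz: "wall i \<noteq> 0" by (rule wall_nonzero)
  have w: "regular \<sigma> (wall i)"
    by (cases i) (simp_all add: s ind)
  have ws: "substitute \<sigma> (wall i) = wall i"
    by (cases i) (simp_all add: s ind bt_simps, simp_all add: field_simps power2_eq_square)
  have r: "regular \<sigma> (simple_root i) \<and> substitute \<sigma> (simple_root i) = - simple_root i"
    by (cases i) (simp_all add: s ind bt_simps)
  have rs: "regular \<sigma> (slope i)" and ss: "substitute \<sigma> (slope i) = - slope i"
    unfolding slope_def using w ws r nz by (simp_all add: s)
  have reg: "regular \<sigma> (bt i (indet v))" for v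
    using rs by (cases i; cases v) (simp_all add: s bt_simps)
  have inv: "substitute \<sigma> (bt i (indet v)) = indet v" for v
    using rs ss
    by (cases i; cases v) (simp_all add: s ind bt_simps, simp_all add: field_simps power2_eq_square)
  from involutive_substitution[OF reg[folded \<sigma>] inv[folded \<sigma>]] show ?thesis by (simp add: bt)
qed


section \<open>Compatibility with the Hamiltonian flow\<close>

text \<open>
  The Hamiltonian has a simple pole in \<open>t\<close>; multiplied by \<open>t\<close>, its vector field is polynomial. Since
  \<open>t\<close> is fixed by all transformations, \<open>d/dt\<close> may be replaced by \<open>t d/dt\<close>.
\<close>

fun velocity :: "var \<Rightarrow> ratfun" where
  "velocity VX = 3 / 4 * vy^2 + 3 * vt * vy + (3 * va3 - 1) * vx + 3 / 4 * va1 * vz - 3 / 2 * va3 * vq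
     + 3 / 4 * (8 * vx * vq * vp - 8 * vx^2 * vp + vz^2 * vw - 2 * vq^2 * vp - 4 * vp^2
         + 4 * vw^2 + 8 * vy * vw + 8 * vw * vp + 8 * vt * vw)"
| "velocity VY = - ((3 * va3 - 1) * vy + 6 * (va1 + va2 + va3) * vp
     + 3 / 4 * (8 * vy * vq * vp + 8 * vz * vw * vp - 16 * vx * vy * vp - 8 * vp))"
| "velocity VZ = 3 / 2 * vz^2 * vw + 3 / 2 * vt * vz^2 + (3 * va1 + 3 * va2 - 2) / 2 * vz
     + 3 / 4 * (8 * vx * vz * vp - 4 * vz * vq * vp + 2 * vz^2 * vp + vy * vz^2 + 16 * vw * vp
         + 8 * vy * vw + 4 * vy^2 + 8 * vy * vp + 8 * vt * vy)"
| "velocity VW = - (3 / 2 * vz * vw^2 + 3 * vt * vz * vw + (3 * va1 + 3 * va2 - 2) / 2 * vw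
     + 3 / 2 * vt * va1 + 3 / 4 * va1 * (2 * vp + vy)
     + 3 / 4 * (8 * vx * vw * vp - 4 * vw * vq * vp + 4 * vz * vw * vp + 2 * vy * vz * vw))"
| "velocity VQ = - 12 * vp^2 - 12 * vt * vp - (3 * va1 + 3 * va2 + 3 * va3 - 2) * vq - 6 * vt^2
     + 3 / 4 * va1 * (8 * vx + 2 * vz) + 6 * (va2 + va3) * vx
     + 3 / 4 * (8 * vx * vy * vq - 4 * vz * vw * vq + 8 * vx * vz * vw - 8 * vx^2 * vy
         + 2 * vz^2 * vw - 2 * vy * vq^2 + 8 * vw^2 - 8 * vy * vp + 8 * vy * vw - 8 * vx)"
| "velocity VP = (3 * va1 + 3 * va2 + 3 * va3 - 2) * vp + 3 / 2 * va3 * vy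
     - 3 / 4 * (8 * vx * vy * vp - 4 * vz * vw * vp - 4 * vy * vq * vp)"
| "velocity VT = vt"
| "velocity VA1 = 0"
| "velocity VA2 = 0"
| "velocity VA3 = 0"

lemma flow_velocity: "vt * flow v = velocity v"
  by (cases v)
    (simp_all add: Ham_def hamiltonian_def pd.deriv_simps pd.divide_const pd_indet,
      simp_all add: field_simps power2_eq_square indet_nonzero)

definition tddt :: "ratfun \<Rightarrow> ratfun" where
  "tddt f = vt * ddt f"

global_interpretation tddt: derivation tddt
  by unfold_locales
    (simp add: twisted_derivation_def tddt_def ddt.add ddt.mult ddt.cst algebra_simps)

lemma tddt_indet: "tddt (indet v) = velocity v"
  by (simp add: tddt_def ddt_indet flow_velocity del: flow.simps velocity.simps)

lemmas tddt_simps = tddt.deriv_simps tddt.divide_const tddt_indet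

text \<open>
  Quotient and remainder of \<open>t f\<^sub>i'\<close> on division by the wall \<open>f\<^sub>i\<close>; the remainder is divisible by the
  simple root. Division with respect to the variable \<open>y\<close>, \<open>w\<close>, \<open>w\<close>, \<open>p\<close>, in which the wall is linear,
  produces these formulas.
\<close>

fun rate :: "gen \<Rightarrow> ratfun" where
  "rate S0 = 12 * vx * vp + 3 / 2 * vy * vz + 3 * vz * vw + 3 * vz * vp + 3 * vz * vt - 6 * vq * vp - 3 * va3 + 1"
| "rate S1 = - 6 * vx * vp - 3 / 2 * vy * vz - 3 / 2 * vz * vw - 3 * vz * vp - 3 * vz * vt + 3 * vq * vp
     - 3 / 2 * (va1 + va2) + 1"
| "rate S2 = 3 * vx * vy + 3 / 4 * vy * vz - 3 / 2 * vy * vq - 3 / 2 * vz * vw + 3 / 2 * vz * vp + 3 / 2 * vz * vt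
     - 3 / 2 * (va1 + va2) + 1"
| "rate S3 = - 6 * vx * vy + 3 * vy * vq + 3 * vz * vw + 3 * (va1 + va2 + va3) - 2"

fun source :: "gen \<Rightarrow> ratfun" where
  "source S0 = 6 * vp - 3 / 4 * vz ^ 2"
| "source S1 = - 3 / 4 * vy - 3 / 2 * vp - 3 / 2 * vt"
| "source S2 = 3 / 4 * vy + 3 / 2 * vp + 3 / 2 * vt"
| "source S3 = 3 / 2 * vy"

lemma tddt_wall: "tddt (wall i) = wall i * rate i + simple_root i * source i"
  by (cases i) (simp_all add: tddt_simps, simp_all add: field_simps power2_eq_square)

lemma tddt_simple_root: "tddt (simple_root i) = 0"
  by (cases i) (simp_all add: tddt_simps)

text \<open>Differentiate \<open>\<alpha>\<^sub>i = c\<^sub>i f\<^sub>i\<close>, whose left-hand side is constant: the slope satisfies a Riccati equation.\<close>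

lemma tddt_slope: "tddt (slope i) = - slope i * (rate i + slope i * source i)"
proof -
  have "0 = tddt (slope i * wall i)" by (simp add: tddt_simple_root flip: simple_root_eq)
  also have "\<dots> = wall i * (tddt (slope i) + slope i * (rate i + slope i * source i))"
    unfolding tddt.mult tddt_wall simple_root_eq by (simp add: algebra_simps)
  finally show ?thesis
    by (simp add: wall_nonzero eq_neg_iff_add_eq_0)
qed

global_interpretation bt: endomorphism "bt i" for i
  using bt_involutive_endo by unfold_locales blast

lemma bt_wall: "bt i (wall i) = wall i" and bt_simple_root: "bt i (simple_root i) = - simple_root i"
  by (cases i; simp add: bt_simps bt.hom_simps; simp add: field_simps power2_eq_square)+

lemma bt_slope: "bt i (slope i) = - slope i"
  by (simp add: slope_def bt.divide bt_wall bt_simple_root del: wall.simps simple_root.simps)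

text \<open>
  The four lemmas \<open>bt_velocity_S0\<close> to \<open>bt_velocity_S3\<close> first expand both sides with the Riccati
  equation for the slope \<open>c\<close> and only then replace the parameter of the transformation by \<open>c\<close> times
  the wall. After that replacement both sides are the same polynomial.
  For \<open>s\<^sub>0\<close> the replaced parameter is \<open>\<alpha>\<^sub>1\<close>, since \<open>\<alpha>\<^sub>0\<close> is not an independent variable.
\<close>

lemma bt_velocity_S0: "bt S0 (velocity v) = tddt (bt S0 (indet v))"
proof -
  define c where "c = slope S0"
  have c: "tddt c = - c * (rate S0 + c * source S0)"
    unfolding c_def by (rule tddt_slope)
  have eliminate: "va1 = 1 - va2 - va3 - c * (vy + vz ^ 2 / 4)"
    using simple_root_eq[of S0] by (simp add: c_def algebra_simps)
  show ?thesis
    by (cases v; simp add: bt_S0 bt.hom_simps tddt_simps c flip: c_def;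
        simp add: eliminate field_simps power2_eq_square power3_eq_cube)
qed

lemma bt_velocity_S1: "bt S1 (velocity v) = tddt (bt S1 (indet v))"
proof -
  define c where "c = slope S1"
  have c: "tddt c = - c * (rate S1 + c * source S1)"
    unfolding c_def by (rule tddt_slope)
  have eliminate: "va1 = c * vw"
    using simple_root_eq[of S1] by (simp add: c_def algebra_simps)
  show ?thesis
    by (cases v; simp add: bt_S1 bt.hom_simps tddt_simps c flip: c_def;
        simp add: eliminate field_simps power2_eq_square power3_eq_cube)
qed

lemma bt_velocity_S3: "bt S3 (velocity v) = tddt (bt S3 (indet v))"
proof -
  define c where "c = slope S3"
  have c: "tddt c = - c * (rate S3 + c * source S3)"
    unfolding c_def by (rule tddt_slope)
  have eliminate: "va3 = c * vp"
    using simple_root_eq[of S3] by (simp add: c_def algebra_simps)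
  show ?thesis
    by (cases v; simp add: bt_S3 bt.hom_simps tddt_simps c flip: c_def;
        simp add: eliminate field_simps power2_eq_square power3_eq_cube)
qed

text \<open>
  The image of \<open>w\<close> is the most complicated one. It is obtained from the invariant wall \<open>f\<^sub>2\<close>, which
  differs from \<open>w\<close> by a polynomial in the variables that have been dealt with.
\<close>

lemma bt_velocity_S2: "bt S2 (velocity v) = tddt (bt S2 (indet v))"
proof -
  define c where "c = slope S2"
  have c: "tddt c = - c * (rate S2 + c * source S2)"
    unfolding c_def by (rule tddt_slope)
  have eliminate: "va2 = c * (vw + vp + vy / 2 + vx * vz / 2 - vz * vq / 4 + vt)"
    using simple_root_eq[of S2] by (simp add: c_def algebra_simps)
  have except_w: "bt S2 (tddt (indet v)) = tddt (bt S2 (indet v))" if "v \<noteq> VW" for v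
    using that
    by (cases v; simp add: bt_S2 bt.hom_simps tddt_simps c flip: c_def;
        simp add: eliminate field_simps power2_eq_square power3_eq_cube)
  have "bt S2 (rate S2) = rate S2 + c * (source S2 + bt S2 (source S2))"
    by (simp add: bt_S2 bt.hom_simps flip: c_def)
      (simp add: eliminate field_simps power2_eq_square)
  then have wall: "bt S2 (tddt (wall S2)) = tddt (bt S2 (wall S2))"
    unfolding tddt_wall bt_wall
    by (simp add: simple_root_eq bt.hom_simps bt_wall bt_slope c_def algebra_simps
        del: wall.simps simple_root.simps rate.simps source.simps)
  have w: "vw = wall S2 - (vp + vy / 2 + vx * vz / 2 - vz * vq / 4 + vt)"
    by simp
  have "bt S2 (tddt vw) = tddt (bt S2 vw)"
    unfolding w
    by (simp add: bt.hom_simps tddt.deriv_simps tddt.divide_const except_w wall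
        del: wall.simps)
  with except_w show ?thesis
    by (cases "v = VW") (simp_all flip: tddt_indet del: velocity.simps)
qed

text \<open>Both composites are derivations along \<open>s\<^sub>i\<close>, so the comparison on variables suffices.\<close>

lemma bt_ddt: "bt i (ddt f) = ddt (bt i f)"
proof -
  have "bt i (tddt g) = tddt (bt i g)" for g
  proof (rule twisted_derivation_eqI[where \<phi> = "bt i" and D = "bt i \<circ> tddt" and E = "tddt \<circ> bt i", simplified])
    show "endo (bt i)" by (rule bt.endo)
    show "twisted_derivation (bt i) (bt i \<circ> tddt)" "twisted_derivation (bt i) (tddt \<circ> bt i)"
      by (simp_all add: twisted_derivation_def bt.hom_simps tddt.deriv_simps)
    show "bt i (tddt (indet v)) = tddt (bt i (indet v))" for v
      unfolding tddt_indet
      using bt_velocity_S0 bt_velocity_S1 bt_velocity_S2 bt_velocity_S3 by (cases i) blast+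
  qed
  moreover have "bt i vt = vt" by (cases i) (simp_all add: bt_simps)
  ultimately show ?thesis
    using indet_nonzero[of VT] by (simp add: tddt_def bt.mult)
qed

lemma baecklund_bt: "baecklund (bt i)"
proof -
  have "bij (bt i)"
    using bt_involutive_endo[of i] by (intro o_bij[of "bt i"]) auto
  then show ?thesis
    by (simp add: baecklund_def field_aut_def bt.hom_simps bt_ddt)
qed

lemma bt_coords: "map (bt i) coords = images i"
  by (cases i) (simp_all add: coords_def images_def bt_indet Let_def bt.hom_simps)


section \<open>The Coxeter relations\<close>

lemmas bt_expand = bt_simps bt.hom_simps

text \<open>
  The element \<open>k\<close> is, up to sign, the Poisson bracket of the two walls: it is fixed by \<open>s\<^sub>1\<close> and \<open>s\<^sub>2\<close>, and each of these
  moves the wall of the other by a multiple of \<open>k\<close>. All images of the two slopes are then fractions in \<open>w\<close>, \<open>F\<close> and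
  the two numerators \<open>E\<close> and \<open>G\<close>. The relation needs only the identities \<open>A\<close>, \<open>B\<close> and \<open>C\<close> between these
  images, after which it is a polynomial identity in the slopes.
\<close>

lemma braid_12: "bt S1 (bt S2 (bt S1 (indet v))) = bt S2 (bt S1 (bt S2 (indet v)))"
proof -
  define F k where "F = wall S2" and "k = (2 * vx - vq) / 4"
  define E where "E = vw * F + va1 * k"
  define G where "G = vw * F - va2 * k"
  have nz: "vw \<noteq> 0" "F \<noteq> 0"
    using wall_nonzero[of S1] wall_nonzero[of S2] by (simp_all add: F_def)
  have s: "slope S1 = va1 / vw" "slope S2 = va2 / F"
    by (simp_all add: slope_def F_def)
  have F1: "bt S1 F = E / vw"
    unfolding F_def E_def k_def
    by (simp add: bt_expand s) (simp add: nz field_simps)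
  have w2: "bt S2 vw = G / F"
    unfolding G_def k_def by (simp add: bt_expand s nz field_simps)
  have F2: "bt S2 F = F"
    unfolding F_def by (rule bt_wall)
  have w1: "bt S1 vw = vw" by (rule bt_S1)
  have k: "bt S1 k = k" "bt S2 k = k"
    unfolding k_def by (simp_all add: bt_expand algebra_simps)
  have nz': "E \<noteq> 0" "G \<noteq> 0"
    using bt.eq_0_iff[of S1 F] bt.eq_0_iff[of S2 vw] nz unfolding F1 w2 by auto
  have EG: "bt S1 E = vw * F" "bt S1 G = G" "bt S2 E = E" "bt S2 G = vw * F"
    unfolding E_def G_def
    by (simp_all add: bt.hom_simps F1 F2 w2 w1 k bt_S1(8-10) bt_S2(8-10) nz E_def G_def field_simps)
  have s21: "bt S2 (slope S1) = (va1 + va2) * F / G" and s12: "bt S1 (slope S2) = (va1 + va2) * vw / E"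
    by (simp_all add: s bt.hom_simps F1 w2 bt_S1(8-10) bt_S2(8-10))
  have s121: "bt S1 (bt S2 (slope S1)) = va2 * E / (vw * G)"
    by (simp add: s21 bt.hom_simps F1 EG bt_S1(8-10))
  have s212: "bt S2 (bt S1 (slope S2)) = va1 * G / (F * E)"
    by (simp add: s12 bt.hom_simps w2 EG bt_S2(8-10))
  have A: "bt S1 (slope S2) = slope S2 + bt S2 (bt S1 (slope S2))"
    unfolding s212 unfolding s12 unfolding s
    by (simp add: nz nz' divide_simps) (simp add: E_def G_def algebra_simps)
  have B: "bt S2 (slope S1) = slope S1 + bt S1 (bt S2 (slope S1))"
    unfolding s121 unfolding s21 unfolding s
    by (simp add: nz nz' divide_simps) (simp add: E_def G_def algebra_simps)
  have C: "bt S2 (bt S1 (slope S2)) * bt S1 (bt S2 (slope S1)) = slope S1 * slope S2"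
    unfolding s121 s212 unfolding s by (simp add: nz nz' divide_simps)
  define a b where "a = bt S2 (bt S1 (slope S2))" and "b = bt S1 (bt S2 (slope S1))"
  note C = C[folded a_def b_def]
  have A': "bt S2 a = slope S2 + a" and B': "bt S1 b = slope S1 + b"
    using A B bt_involutive_endo by (simp_all add: a_def b_def)
  note A = A[folded a_def] and B = B[folded b_def]
  show ?thesis
    using C
    by (cases v; simp add: bt_expand bt_slope A B A' B'; simp add: field_simps power2_eq_square)
qed

text \<open>
  The local computation for a double bond, in the invariant form in which it serves both ends of the
  diagram: \<open>F\<close> and \<open>w\<close> are the walls (up to a numerical factor), \<open>a\<close> and \<open>b\<close> the simple roots, \<open>c\<close>
  and \<open>d\<close> the slopes. The numerators of the successive images of the walls are built from \<open>K, L, M, N\<close>;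
  the process stops there because \<open>\<phi>\<close> fixes \<open>M\<close> and \<open>\<psi>\<close> fixes \<open>N\<close>. The
  conclusions are the identities between the six images of the slopes to which the two sides of the
  braid relation of length four reduce.
\<close>

lemma order_4_braid_identities:
  assumes "endo \<phi>" "endo \<psi>"
    and F: "\<phi> F = F" "\<psi> F = F + b * z / (2 * w) + b ^ 2 / (4 * w ^ 2)" "F \<noteq> 0"
    and w: "\<phi> w = w - a * z / (2 * F)" "\<psi> w = w" "w \<noteq> 0"
    and z: "\<phi> z = z" "\<psi> z = z + b / w"
    and a: "\<phi> a = - a" "\<psi> a = a + b" and b: "\<phi> b = b + 2 * a" "\<psi> b = - b"
  defines "c \<equiv> a / F" and "d \<equiv> b / w"
  shows "\<psi> (\<phi> (\<psi> c)) = c + \<phi> (\<psi> c) - \<psi> c"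
    and "\<phi> (\<psi> (\<phi> d)) = d + \<psi> (\<phi> d) - \<phi> d"
    and "\<phi> (\<psi> c) * \<phi> d + \<psi> (\<phi> d) * \<psi> c = (c + \<phi> (\<psi> c)) * (d + \<psi> (\<phi> d))"
proof -
  interpret \<phi>: endomorphism \<phi> by standard fact
  interpret \<psi>: endomorphism \<psi> by standard fact
  note hom = \<phi>.hom_simps \<psi>.hom_simps a b z
  define K where "K = 2 * F * w - a * z"
  define L where "L = 4 * F * w ^ 2 + 2 * b * z * w + b ^ 2"
  define M where "M = 4 * F * w ^ 2 - 2 * a * z * w - b ^ 2 - 2 * a * b"
  define N where "N = 4 * F ^ 2 * w ^ 2 + 2 * b * F * w * z - a * (a + b) * z ^ 2 + F * (b + 2 * a) ^ 2"
  have \<phi>w: "\<phi> w = K / (2 * F)" and \<psi>F: "\<psi> F = L / (4 * w ^ 2)"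
    using F(3) w(3) unfolding F w K_def L_def by (simp_all add: field_simps power2_eq_square)
  have \<psi>K: "\<psi> K = M / (2 * w)" and \<phi>L: "\<phi> L = N / F"
    unfolding K_def L_def hom \<phi>w \<psi>F F(1) w(2)
    using F(3) w(3) by (simp_all add: K_def L_def M_def N_def field_simps power2_eq_square)
  have \<phi>M: "\<phi> M = M" and \<psi>N: "\<psi> N = N"
    unfolding M_def N_def hom \<phi>w \<psi>F F(1) w(2)
    using F(3) w(3) by (simp_all add: K_def L_def field_simps power2_eq_square)
  have nz: "F \<noteq> 0" "w \<noteq> 0" "K \<noteq> 0" "L \<noteq> 0" "M \<noteq> 0" "N \<noteq> 0"
    using F(3) w(3) \<phi>.eq_0_iff[of w] \<psi>.eq_0_iff[of F] \<psi>.eq_0_iff[of K] \<phi>.eq_0_iff[of L]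
    unfolding \<phi>w \<psi>F \<psi>K \<phi>L by auto
  have 1: "\<psi> c = 4 * (a + b) * w ^ 2 / L" "\<phi> d = 2 * (b + 2 * a) * F / K"
    unfolding c_def d_def by (simp_all add: hom \<psi>F \<phi>w)
  have 2: "\<phi> (\<psi> c) = (a + b) * K ^ 2 / (F * N)" "\<psi> (\<phi> d) = (b + 2 * a) * L / (w * M)"
    unfolding 1 by (simp_all add: hom \<psi>F \<phi>w F(1) w(2) \<psi>K \<phi>L nz field_simps power2_eq_square)
  have 3: "\<psi> (\<phi> (\<psi> c)) = a * M ^ 2 / (L * N)" "\<phi> (\<psi> (\<phi> d)) = 2 * b * N / (K * M)"
    unfolding 2 by (simp_all add: hom \<psi>F \<phi>w F(1) w(2) \<psi>K \<phi>L \<phi>M \<psi>N nz field_simps power2_eq_square)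
  show "\<psi> (\<phi> (\<psi> c)) = c + \<phi> (\<psi> c) - \<psi> c"
    unfolding 3 unfolding 2 unfolding 1 unfolding c_def
    by (simp add: nz divide_simps)
      (simp add: K_def L_def M_def N_def algebra_simps power2_eq_square)
  show "\<phi> (\<psi> (\<phi> d)) = d + \<psi> (\<phi> d) - \<phi> d"
    unfolding 3 unfolding 2 unfolding 1 unfolding d_def
    by (simp add: nz divide_simps)
      (simp add: K_def L_def M_def N_def algebra_simps power2_eq_square)
  show "\<phi> (\<psi> c) * \<phi> d + \<psi> (\<phi> d) * \<psi> c = (c + \<phi> (\<psi> c)) * (d + \<psi> (\<phi> d))"
    unfolding 3 unfolding 2 unfolding 1 unfolding c_def d_def
    by (simp add: nz divide_simps)
      (simp add: K_def L_def M_def N_def algebra_simps power2_eq_square)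
qed

lemma bt_bt [simp]: "bt i (bt i f) = f"
  using bt_involutive_endo by blast

lemma braid_01:
  "bt S0 (bt S1 (bt S0 (bt S1 (indet v)))) = bt S1 (bt S0 (bt S1 (bt S0 (indet v))))"
proof -
  define c where "c = slope S0"
  define d where "d = slope S1"
  define a where "a = bt S0 (bt S1 c)"
  define b where "b = bt S1 (bt S0 d)"
  note dihedral = order_4_braid_identities[where \<phi> = "bt S0" and \<psi> = "bt S1" and F = "wall S0" and w = "wall S1"
      and z = vz and a = "simple_root S0" and b = "simple_root S1", folded slope_def, folded c_def d_def]
  have "bt S1 (wall S0) = wall S0 + simple_root S1 * vz / (2 * wall S1) + simple_root S1 ^ 2 / (4 * wall S1 ^ 2)"
    using indet_nonzero[of VW] by (simp add: bt_expand slope_def) (simp add: field_simps power2_eq_square)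
  moreover have "bt S0 (wall S1) = wall S1 - simple_root S0 * vz / (2 * wall S0)"
    by (simp add: bt_expand slope_def)
  moreover have "bt S0 vz = vz" "bt S1 vz = vz + d" "bt S1 (simple_root S0) = simple_root S0 + simple_root S1"
    "bt S0 (simple_root S1) = simple_root S1 + 2 * simple_root S0"
    by (simp_all add: bt_expand d_def)
  ultimately have relations: "bt S1 a = c + a - bt S1 c" "bt S0 b = d + b - bt S0 d"
    "a * bt S0 d + b * bt S1 c = (c + a) * (d + b)"
    unfolding a_def b_def
    by - (rule dihedral; (assumption | rule bt.endo bt_wall bt_simple_root wall_nonzero))+
  have "bt S0 c = - c" "bt S1 d = - d" "bt S0 (bt S1 c) = a" "bt S1 (bt S0 d) = b"
      "bt S0 a = bt S1 c" "bt S1 b = bt S0 d"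
    by (simp_all add: a_def b_def c_def d_def bt_slope)
  with relations(3) show ?thesis
    by (cases v; simp add: bt_expand relations flip: c_def d_def;
        simp add: relations(1,2) field_simps)
qed

text \<open>
  This end of the diagram matches the other one when \<open>p\<close> is doubled: \<open>s\<^sub>2\<close> changes \<open>2 p\<close> exactly as
  \<open>s\<^sub>1\<close> changes \<open>y + z\<^sup>2/4\<close>. Hence the factor \<open>2\<close> in the wall and the half slope.
\<close>

lemma braid_32:
  "bt S3 (bt S2 (bt S3 (bt S2 (indet v)))) = bt S2 (bt S3 (bt S2 (bt S3 (indet v))))"
proof -
  define c where "c = slope S3 / 2"
  define d where "d = slope S2"
  define a where "a = bt S3 (bt S2 c)"
  define b where "b = bt S2 (bt S3 d)"
  have s: "slope S3 = 2 * c" "slope S2 = d" by (simp_all add: c_def d_def)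
  have c: "c = simple_root S3 / (2 * vp)" by (simp add: c_def slope_def)
  note dihedral = order_4_braid_identities[where \<phi> = "bt S3" and \<psi> = "bt S2" and F = "2 * vp" and w = "wall S2"
      and z = vz and a = "simple_root S3" and b = "simple_root S2", folded slope_def c, folded d_def]
  have "bt S2 (2 * vp) = 2 * vp + simple_root S2 * vz / (2 * wall S2) + simple_root S2 ^ 2 / (4 * wall S2 ^ 2)"
    using wall_nonzero[of S2]
    by (simp add: bt_S2 bt.hom_simps slope_def del: wall.simps simple_root.simps)
      (simp add: field_simps power2_eq_square del: wall.simps)
  moreover have "bt S3 (wall S2) = wall S2 - simple_root S3 * vz / (2 * (2 * vp))"
    using indet_nonzero[of VP] by (simp add: bt_expand slope_def) (simp add: field_simps)
  moreover have "bt S3 vz = vz" "bt S2 vz = vz + d" "bt S2 (simple_root S3) = simple_root S3 + simple_root S2"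
    "bt S3 (simple_root S2) = simple_root S2 + 2 * simple_root S3" "bt S3 (2 * vp) = 2 * vp" "2 * vp \<noteq> 0"
    using indet_nonzero[of VP] by (simp_all add: bt_expand d_def)
  ultimately have relations: "bt S2 a = c + a - bt S2 c" "bt S3 b = d + b - bt S3 d"
    "a * bt S3 d + b * bt S2 c = (c + a) * (d + b)"
    unfolding a_def b_def
    by - (rule dihedral; (assumption | rule bt.endo bt_wall bt_simple_root wall_nonzero))+
  have reflections: "bt S3 c = - c" "bt S2 d = - d" "bt S3 (bt S2 c) = a" "bt S2 (bt S3 d) = b"
      "bt S3 a = bt S2 c" "bt S2 b = bt S3 d"
    by (simp_all add: a_def b_def c_def d_def bt_slope bt.hom_simps)
  \<comment> \<open>The factor \<open>e\<close> absorbs the numeral that clearing denominators leaves in the image of \<open>w\<close>.\<close>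
  have "a * (bt S3 d * e) = ((c + a) * (d + b) - b * bt S2 c) * e" for e
    unfolding relations(3)[symmetric] by (simp add: algebra_simps)
  note relations = relations(1,2) reflections this
  show ?thesis
    by (cases v; simp add: bt_expand relations s;
        simp add: relations field_simps power2_eq_square)
qed

text \<open>Each of the two transformations fixes the wall and the root of the other, hence its slope.\<close>

lemma commute_02: "bt S0 (bt S2 (indet v)) = bt S2 (bt S0 (indet v))"
proof -
  have "bt S0 (wall S2) = wall S2" "bt S2 (wall S0) = wall S0"
    by (simp_all add: bt_expand, simp_all add: field_simps power2_eq_square)
  then have "bt S0 (slope S2) = slope S2" "bt S2 (slope S0) = slope S0"
    unfolding slope_def by (simp_all add: bt_expand del: wall.simps)
  then show ?thesis
    by (cases v; simp add: bt_expand; simp add: field_simps)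
qed

lemma commute_03: "bt S0 (bt S3 (indet v)) = bt S3 (bt S0 (indet v))"
  and commute_13: "bt S1 (bt S3 (indet v)) = bt S3 (bt S1 (indet v))"
  by (cases v; simp add: bt_expand slope_def)+

abbreviation bts :: "gen list \<Rightarrow> ratfun \<Rightarrow> ratfun" where
  "bts u \<equiv> foldr bt u"

lemma endo_bts: "endo (bts u)"
  by (induction u) (simp_all add: endo_def bt.hom_simps)

lemma bts_eqI:
  assumes "\<And>v. bts u (indet v) = bts w (indet v)"
  shows "bts u f = bts w f"
  using endo_eqI[OF endo_bts endo_bts assms] by (rule fun_cong)

lemma bt_relations:
  "bt S0 (bt S1 (bt S0 (bt S1 f))) = bt S1 (bt S0 (bt S1 (bt S0 f)))"
  "bt S3 (bt S2 (bt S3 (bt S2 f))) = bt S2 (bt S3 (bt S2 (bt S3 f)))"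
  "bt S1 (bt S2 (bt S1 f)) = bt S2 (bt S1 (bt S2 f))"
  "bt S0 (bt S2 f) = bt S2 (bt S0 f)" "bt S0 (bt S3 f) = bt S3 (bt S0 f)"
  "bt S1 (bt S3 f) = bt S3 (bt S1 f)"
  using bts_eqI[of "[S0, S1, S0, S1]" "[S1, S0, S1, S0]"]
    bts_eqI[of "[S3, S2, S3, S2]" "[S2, S3, S2, S3]"]
    bts_eqI[of "[S1, S2, S1]" "[S2, S1, S2]"] bts_eqI[of "[S0, S2]" "[S2, S0]"]
    bts_eqI[of "[S0, S3]" "[S3, S0]"] bts_eqI[of "[S1, S3]" "[S3, S1]"]
  by (simp_all add: braid_01 braid_32 braid_12 commute_02 commute_03 commute_13)


section \<open>The presented group as a monoid of words\<close>

text \<open>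
  The elements of the presented group, as a type of class \<open>monoid_mult\<close>, so that products can be
  computed by rewriting. Inverses need no operation of their own because the generators are
  involutions; consequently the formal inverse of a letter equals the letter.
\<close>

quotient_type refl_group = "gen word" / "word_eq D42_relators"
  by (rule equivpI) (auto intro!: reflpI sympI transpI intro: word_eq.refl word_eq.sym word_eq.trans)

instantiation refl_group :: monoid_mult
begin
lift_definition one_refl_group :: refl_group is "[]" .
lift_definition times_refl_group :: "refl_group \<Rightarrow> refl_group \<Rightarrow> refl_group" is "(@)"
  by (rule word_eq.append)
instance
  by standard (transfer, simp add: word_eq.refl)+
end

lift_definition reflection :: "gen \<Rightarrow> refl_group" is "\<lambda>i. [(i, True)]" .

abbreviation refls :: "gen list \<Rightarrow> refl_group" where
  "refls u \<equiv> prod_list (map reflection u)"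

lemma refl_refl: "reflection i * reflection i = 1"
  by transfer (simp add: word_eq.relator D42_relators_def)

lemma refl_refl_left [simp]: "reflection i * (reflection i * w) = w"
  by (simp add: refl_refl flip: mult.assoc)

lemma abs_refl_group_append: "abs_refl_group (u @ v) = abs_refl_group u * abs_refl_group v"
  by (simp add: times_refl_group.abs_eq)

lemma abs_refl_group_word: "abs_refl_group u = refls (map fst u)"
proof (induction u)
  case (Cons a u)
  obtain i b where a: "a = (i, b)" by force
  have "abs_refl_group [(i, True)] * abs_refl_group [(i, False)] = 1"
    by (simp add: times_refl_group.abs_eq one_refl_group.abs_eq refl_group.abs_eq_iff)
      (use word_eq.cancel[of D42_relators i True] in simp)
  then have "abs_refl_group [(i, False)] = reflection i"
    by (metis mult_1_right reflection.abs_eq refl_refl_left)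
  then have "abs_refl_group [a] = reflection i"
    by (cases b) (simp_all add: a reflection.abs_eq)
  then show ?case
    using Cons.IH abs_refl_group_append[of "[a]" u] by (simp add: a)
qed (simp add: one_refl_group.abs_eq)

lemma word_eq_iff: "word_eq D42_relators u v \<longleftrightarrow> refls (map fst u) = refls (map fst v)"
  by (metis abs_refl_group_word refl_group.abs_eq_iff)

lemma relator_refls:
  assumes "coxeter_relator i j n \<in> D42_relators"
  shows "refls (concat (replicate n [i, j])) = 1"
proof -
  have "map fst (coxeter_relator i j n) = concat (replicate n [i, j])"
    by (induction n) (simp_all add: coxeter_relator_def)
  then show ?thesis
    using word_eq.relator[OF assms] by (simp add: word_eq_iff)
qed

text \<open>
  Braid form of the relators, with an arbitrary right factor \<open>w\<close> so that they apply inside products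
  that are bracketed to the right.
\<close>

lemma refl_relations:
  "reflection S0 * (reflection S1 * (reflection S0 * (reflection S1 * w))) =
     reflection S1 * (reflection S0 * (reflection S1 * (reflection S0 * w)))"
  "reflection S2 * (reflection S3 * (reflection S2 * (reflection S3 * w))) =
     reflection S3 * (reflection S2 * (reflection S3 * (reflection S2 * w)))"
  "reflection S1 * (reflection S2 * (reflection S1 * w)) = reflection S2 * (reflection S1 * (reflection S2 * w))"
  "reflection S0 * (reflection S2 * w) = reflection S2 * (reflection S0 * w)"
  "reflection S0 * (reflection S3 * w) = reflection S3 * (reflection S0 * w)"
  "reflection S1 * (reflection S3 * w) = reflection S3 * (reflection S1 * w)"
proof -
  have move: "x * w = refls (rev u) * w" if "x * refls u = 1" for x u w
  proof -
    have "refls u * (refls (rev u) * w) = w" for w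
      by (induction u arbitrary: w) (simp_all add: mult.assoc)
    with that show ?thesis by (metis mult.assoc mult_1_left)
  qed
  have "D42_relators \<supseteq> {coxeter_relator S0 S1 4, coxeter_relator S2 S3 4, coxeter_relator S1 S2 3,
      coxeter_relator S0 S2 2, coxeter_relator S0 S3 2, coxeter_relator S1 S3 2}"
    by (simp add: D42_relators_def)
  then have
    "refls [S0, S1, S0, S1] * refls [S0, S1, S0, S1] = 1"
    "refls [S2, S3, S2, S3] * refls [S2, S3, S2, S3] = 1"
    "refls [S1, S2, S1] * refls [S2, S1, S2] = 1"
    "refls [S0, S2] * refls [S0, S2] = 1"
    "refls [S0, S3] * refls [S0, S3] = 1"
    "refls [S1, S3] * refls [S1, S3] = 1"
    using relator_refls[of S0 S1 4] relator_refls[of S2 S3 4] relator_refls[of S1 S2 3]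
      relator_refls[of S0 S2 2] relator_refls[of S0 S3 2] relator_refls[of S1 S3 2]
    by (simp_all add: eval_nat_numeral mult.assoc)
  from this[THEN move] show
    "reflection S0 * (reflection S1 * (reflection S0 * (reflection S1 * w))) =
     reflection S1 * (reflection S0 * (reflection S1 * (reflection S0 * w)))"
    "reflection S2 * (reflection S3 * (reflection S2 * (reflection S3 * w))) =
     reflection S3 * (reflection S2 * (reflection S3 * (reflection S2 * w)))"
    "reflection S1 * (reflection S2 * (reflection S1 * w)) = reflection S2 * (reflection S1 * (reflection S2 * w))"
    "reflection S0 * (reflection S2 * w) = reflection S2 * (reflection S0 * w)"
    "reflection S0 * (reflection S3 * w) = reflection S3 * (reflection S0 * w)"
    "reflection S1 * (reflection S3 * w) = reflection S3 * (reflection S1 * w)"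
    by (simp_all add: mult.assoc)
qed


section \<open>Normal forms in the affine Weyl group\<close>

text \<open>
  The axes stand for the coordinates \<open>e\<^sub>1, e\<^sub>2, e\<^sub>3\<close>. The word \<open>axis_word i b\<close> is the conjugate of \<open>s\<^sub>3\<close>
  (for \<open>b = False\<close>) or of \<open>s\<^sub>0\<close> (for \<open>b = True\<close>) that reflects the coordinate \<open>e\<^sub>i\<close> in \<open>0\<close>, respectively
  in \<open>1\<close>.
\<close>

datatype axis = E1 | E2 | E3

fun axis_perm :: "gen \<Rightarrow> axis \<Rightarrow> axis" where
  "axis_perm S1 E1 = E2" | "axis_perm S1 E2 = E1" | "axis_perm S1 E3 = E3"
| "axis_perm S2 E1 = E1" | "axis_perm S2 E2 = E3" | "axis_perm S2 E3 = E2"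
| "axis_perm S0 i = i" | "axis_perm S3 i = i"

fun axis_word :: "axis \<Rightarrow> bool \<Rightarrow> gen list" where
  "axis_word E1 False = [S1, S2, S3, S2, S1]"
| "axis_word E2 False = [S2, S3, S2]"
| "axis_word E3 False = [S3]"
| "axis_word E1 True = [S0]"
| "axis_word E2 True = [S1, S0, S1]"
| "axis_word E3 True = [S2, S1, S0, S1, S2]"

abbreviation axis_refl :: "axis \<Rightarrow> bool \<Rightarrow> refl_group" where
  "axis_refl i b \<equiv> refls (axis_word i b)"

lemma axis_refl_involution: "axis_refl i b * (axis_refl i b * w) = w"
  by (cases i; cases b) (simp_all add: mult.assoc)

text \<open>
  Conjugation by \<open>s\<^sub>1\<close> and \<open>s\<^sub>2\<close> permutes the axes. The words are built for this, and a commutation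
  relation handles the one-letter words. Only \<open>s\<^sub>2\<close> with the word of \<open>E1, False\<close> and \<open>s\<^sub>1\<close> with
  the word of \<open>E3, True\<close> need the braid relation, which moves the letter through from the left to the right.
\<close>

lemma permute_axis_refl:
  assumes "g \<in> {S1, S2}"
  shows "reflection g * axis_refl i b = axis_refl (axis_perm g i) b * reflection g"
proof -
  have "reflection S2 * refls [S1, S2, S3, S2, S1] = refls [S1, S2, S3, S2, S1] * reflection S2"
  proof -
    have "reflection S2 * refls [S1, S2, S3, S2, S1] = refls [S2, S1, S2, S3, S2, S1]"
      by simp
    also have "\<dots> = refls [S1, S2, S1, S3, S2, S1]"
      by (simp add: refl_relations(3)[symmetric])
    also have "\<dots> = refls [S1, S2, S3, S1, S2, S1]"
      by (simp add: refl_relations(6))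
    also have "\<dots> = refls [S1, S2, S3, S2, S1, S2]"
      by (simp add: refl_relations(3)[of 1, simplified])
    finally show ?thesis by (simp add: mult.assoc)
  qed
  moreover have "reflection S1 * refls [S2, S1, S0, S1, S2] = refls [S2, S1, S0, S1, S2] * reflection S1"
  proof -
    have "reflection S1 * refls [S2, S1, S0, S1, S2] = refls [S1, S2, S1, S0, S1, S2]"
      by simp
    also have "\<dots> = refls [S2, S1, S2, S0, S1, S2]"
      by (simp add: refl_relations(3))
    also have "\<dots> = refls [S2, S1, S0, S2, S1, S2]"
      by (simp add: refl_relations(4))
    also have "\<dots> = refls [S2, S1, S0, S1, S2, S1]"
      by (simp add: refl_relations(3)[of 1, simplified])
    finally show ?thesis by (simp add: mult.assoc)
  qed
  ultimately show ?thesis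
    using assms refl_relations(4,6)[of 1]
    by (cases i; cases b; auto simp: mult.assoc refl_refl)
qed

lemma commute_transport:
  fixes g :: "'a :: monoid_mult"
  assumes "g * g = 1" "g * x = x' * g" "g * y = y' * g" "x * y = y * x"
  shows "x' * y' = y' * x'"
proof -
  have "x' * y' * g = g * (x * y)" "y' * x' * g = g * (y * x)"
    by (metis assms(2,3) mult.assoc)+
  then have "x' * y' * g * g = y' * x' * g * g"
    by (simp add: assms(4))
  then show ?thesis
    by (simp add: mult.assoc assms(1))
qed

text \<open>
  Three pairs commute by a defining relation, namely \<open>(s\<^sub>2 s\<^sub>3)\<^sup>4\<close>, \<open>(s\<^sub>0 s\<^sub>3)\<^sup>2\<close> and
  \<open>(s\<^sub>0 s\<^sub>1)\<^sup>4\<close>; every other pair is conjugate to one of them by \<open>s\<^sub>1\<close> and \<open>s\<^sub>2\<close>.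
\<close>

lemma axis_refl_commute:
  assumes "i \<noteq> j"
  shows "axis_refl i b * axis_refl j c = axis_refl j c * axis_refl i b"
proof -
  define C where "C i b j c \<longleftrightarrow> axis_refl i b * axis_refl j c = axis_refl j c * axis_refl i b" for i b j c
  have sym: "C i b j c \<Longrightarrow> C j c i b" for i b j c by (simp add: C_def)
  have perm: "C i b j c \<Longrightarrow> C (axis_perm S1 i) b (axis_perm S1 j) c"
    "C i b j c \<Longrightarrow> C (axis_perm S2 i) b (axis_perm S2 j) c" for i b j c
    
    unfolding C_def by (rule commute_transport[OF refl_refl permute_axis_refl permute_axis_refl]; simp)+
  have "C E2 False E3 False" "C E1 True E3 False" "C E1 True E2 True"
    using refl_relations(1,2,5)[of 1] by (simp_all add: C_def mult.assoc)
  note base = this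
  have "C E1 False E3 False" using perm(1)[OF base(1)] by simp
  note b2 = this
  have "C E1 False E2 False" using perm(2)[OF b2] by simp
  note b3 = this
  have "C E2 True E3 False" using perm(1)[OF base(2)] by simp
  note c2 = this
  have "C E3 True E2 False" using perm(2)[OF c2] by simp
  note c3 = this
  have "C E3 True E1 False" using perm(1)[OF c3] by simp
  note c4 = this
  have "C E2 True E1 False" using perm(2)[OF c4] by simp
  note c5 = this
  have "C E1 True E2 False" using perm(1)[OF c5] by simp
  note c6 = this
  have "C E1 True E3 True" using perm(2)[OF base(3)] by simp
  note d2 = this
  have "C E2 True E3 True" using perm(1)[OF d2] by simp
  note all = base b2 b3 c2 c3 c4 c5 c6 d2 this
  then have "C i b j c"
    using assms all[THEN sym] by (cases i; cases j; cases b; cases c) simp_all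
  then show ?thesis by (simp add: C_def)
qed

definition dihedral_word :: "axis \<Rightarrow> bool list \<Rightarrow> gen list" where
  "dihedral_word i v = concat (map (axis_word i) v)"

lemma dihedral_word_simps:
  "dihedral_word i [] = []" "dihedral_word i (b # v) = axis_word i b @ dihedral_word i v"
  by (simp_all add: dihedral_word_def)

lemma permute_dihedral_word:
  assumes "g \<in> {S1, S2}"
  shows "reflection g * (refls (dihedral_word i v) * w) = refls (dihedral_word (axis_perm g i) v) * (reflection g * w)"
proof (induction v arbitrary: w)
  case (Cons b v)
  show ?case
  proof -
    have "reflection g * (axis_refl i b * x) = axis_refl (axis_perm g i) b * (reflection g * x)" for x
      using permute_axis_refl[OF assms, of i b] by (simp flip: mult.assoc)
    with Cons show ?thesis by (simp add: dihedral_word_simps mult.assoc)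
  qed
qed (simp add: dihedral_word_simps)

lemma dihedral_word_commute:
  assumes "i \<noteq> j"
  shows "refls (dihedral_word i u) * refls (dihedral_word j v) = refls (dihedral_word j v) * refls (dihedral_word i u)"
proof -
  have swap: "x * refls (dihedral_word k w) = refls (dihedral_word k w) * x"
    if "\<And>c. x * axis_refl k c = axis_refl k c * x" for x k w
  proof (induction w)
    case (Cons c w)
    have "x * (axis_refl k c * y) = axis_refl k c * (x * y)" for y
      using that[of c] by (simp flip: mult.assoc)
    then show ?case using Cons by (simp add: dihedral_word_simps mult.assoc)
  qed (simp add: dihedral_word_simps)
  show ?thesis
    by (intro swap swap[symmetric] axis_refl_commute assms)
qed

text \<open>The reduced words of the symmetric group generated by \<open>s\<^sub>1\<close> and \<open>s\<^sub>2\<close>.\<close>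

definition perm_words :: "gen list set" where
  "perm_words = {[], [S1], [S2], [S1, S2], [S2, S1], [S1, S2, S1]}"

definition normal_word :: "(axis \<Rightarrow> bool list) \<Rightarrow> gen list \<Rightarrow> gen list" where
  "normal_word v s = dihedral_word E1 (v E1) @ dihedral_word E2 (v E2) @ dihedral_word E3 (v E3) @ s"

lemma axis_refl_times_alternating:
  assumes "distinct_adj v"
  shows "\<exists>v'. distinct_adj v' \<and> axis_refl i b * refls (dihedral_word i v) = refls (dihedral_word i v')"
proof (cases "v \<noteq> [] \<and> hd v = b")
  case True
  then obtain v' where v: "v = b # v'" by (cases v) auto
  then have "axis_refl i b * refls (dihedral_word i v) = refls (dihedral_word i v')"
    by (simp add: dihedral_word_simps axis_refl_involution)
  moreover have "distinct_adj v'" using assms by (auto simp: v distinct_adj_Cons)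
  ultimately show ?thesis by blast
next
  case False
  then have "distinct_adj (b # v)" using assms by (auto simp: distinct_adj_Cons)
  then show ?thesis by (intro exI[of _ "b # v"]) (simp add: dihedral_word_simps)
qed

lemma dihedral_word_commute_left:
  assumes "i \<noteq> j"
  shows "refls (dihedral_word i u) * (refls (dihedral_word j v) * w) =
    refls (dihedral_word j v) * (refls (dihedral_word i u) * w)"
  using dihedral_word_commute[OF assms, of u v] by (simp flip: mult.assoc)

lemma axis_refl_commute_left:
  assumes "i \<noteq> j"
  shows "axis_refl i b * (refls (dihedral_word j v) * w) = refls (dihedral_word j v) * (axis_refl i b * w)"
  using dihedral_word_commute_left[OF assms, of "[b]" v w] by (simp add: dihedral_word_simps)

lemma axis_refl_times_normal_word:
  assumes "\<forall>i. distinct_adj (v i)"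
  shows "\<exists>v'. (\<forall>i. distinct_adj (v' i)) \<and> axis_refl i b * refls (normal_word v s) = refls (normal_word v' s)"
proof -
  obtain x where x: "distinct_adj x" "axis_refl i b * refls (dihedral_word i (v i)) = refls (dihedral_word i x)"
    using axis_refl_times_alternating assms by blast
  have x': "axis_refl i b * (refls (dihedral_word i (v i)) * w) = refls (dihedral_word i x) * w" for w
    using x(2) by (simp flip: mult.assoc)
  have "axis_refl i b * refls (normal_word v s) = refls (normal_word (v(i := x)) s)"
    using x' by (cases i) (simp_all add: normal_word_def mult.assoc axis_refl_commute_left
        del: axis_word.simps)
  with x(1) assms show ?thesis
    by (intro exI[of _ "v(i := x)"]) simp
qed

lemma perm_words_times:
  assumes "g \<in> {S1, S2}" "s \<in> perm_words"
  shows "\<exists>s' \<in> perm_words. reflection g * refls s = refls s'"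
  using assms refl_relations(3)[of 1] refl_relations(3)[of "reflection S2"]
  by (auto simp: perm_words_def refl_refl)

text \<open>
  The set of normal forms contains the empty word and is stable under left multiplication by
  generators: \<open>s\<^sub>0\<close> and \<open>s\<^sub>3\<close> are axis reflections and are absorbed by the dihedral factor of their
  axis, while \<open>s\<^sub>1\<close> and \<open>s\<^sub>2\<close> permute the dihedral factors and end up in front of \<open>\<sigma>\<close>.
\<close>

lemma normal_word_exists:
  "\<exists>v s. (\<forall>i. distinct_adj (v i)) \<and> s \<in> perm_words \<and> refls u = refls (normal_word v s)"
proof (induction u)
  case Nil
  show ?case
    by (intro exI[of _ "\<lambda>_. []"] exI[of _ "[]"])
      (simp add: normal_word_def dihedral_word_simps perm_words_def)
next
  case (Cons g u)
  then obtain v s where v: "\<forall>i. distinct_adj (v i)" "s \<in> perm_words" "refls u = refls (normal_word v s)"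
    by blast
  show ?case
  proof (cases "g \<in> {S1, S2}")
    case True
    obtain s' where s': "s' \<in> perm_words" "reflection g * refls s = refls s'"
      using perm_words_times[OF True v(2)] by blast
    have "refls (g # u) = refls (normal_word (\<lambda>i. v (axis_perm g i)) s')"
      using True by (auto simp: v(3) normal_word_def mult.assoc permute_dihedral_word s'(2)
          dihedral_word_commute_left[of E2 E1] dihedral_word_commute_left[of E3 E2])
    with v(1) s'(1) show ?thesis
      by (intro exI[of _ "\<lambda>i. v (axis_perm g i)"] exI[of _ s']) (simp del: prod_list.Cons list.map(2))
  next
    case False
    have "reflection S0 = axis_refl E1 True" "reflection S3 = axis_refl E3 False"
      by simp_all
    with False have "\<exists>i b. reflection g = axis_refl i b"
      by (cases g) blast+
    then obtain i b where g: "reflection g = axis_refl i b" by blast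
    from axis_refl_times_normal_word[OF v(1), of i b s] v(2) show ?thesis
      by (auto simp: g v(3) simp del: axis_word.simps)
  qed
qed

text \<open>
  The pair \<open>(s, m)\<close> records that a word in the two reflections of the coordinate \<open>e\<close> sends \<open>e\<close> to
  \<open>s e + m\<close>. The letter in front acts last, by substitution for \<open>e\<close>: it turns \<open>e\<close> into \<open>- e\<close> or \<open>2 - e\<close>.
\<close>

fun affine_image :: "bool list \<Rightarrow> int \<times> int" where
  "affine_image [] = (1, 0)"
| "affine_image (b # v) = (let (s, m) = affine_image v in (- s, if b then m + 2 * s else m))"

text \<open>
  In an alternating word the sign changes with each letter, so all letters \<open>True\<close> add a translation
  with the same sign and nothing cancels. A nonempty word without translation is the single letter
  \<open>False\<close>, which has sign \<open>- 1\<close>. In the induction \<open>k\<close> counts the letters \<open>True\<close>, not counting the first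
  letter, and the sign of the translation relative to \<open>s\<close> is determined by the first letter.
\<close>

lemma affine_image_alternating:
  assumes "distinct_adj v"
  shows "affine_image v = (1, 0) \<longleftrightarrow> v = []"
proof -
  have "\<exists>s k. affine_image (b # v) = (s, if b then - 2 * s * (k + 1) else 2 * s * k) \<and>
      k \<ge> 0 \<and> (s = 1 \<or> s = - 1) \<and> (k = 0 \<and> \<not> b \<longrightarrow> s = - 1)"
    if "distinct_adj (b # v)" for b v
    using that
  proof (induction v arbitrary: b)
    case Nil
    show ?case by (intro exI[of _ "- 1"] exI[of _ 0]) simp
  next
    case (Cons c v)
    then have c: "c = (\<not> b)" and "distinct_adj (c # v)" by auto
    from Cons.IH[OF this(2)] obtain s k where
      *: "affine_image (c # v) = (s, if c then - 2 * s * (k + 1) else 2 * s * k)"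
        "k \<ge> 0" "s = 1 \<or> s = - 1" "k = 0 \<and> \<not> c \<longrightarrow> s = - 1" by blast
    have "affine_image (b # c # v) = (- s, if b then 2 * s * k + 2 * s else - 2 * s * (k + 1))"
      unfolding affine_image.simps(2)[of b] *(1) by (simp add: c)
    then show ?case
      using *(2-4) by (intro exI[of _ "- s"] exI[of _ "if b then k else k + 1"]) (auto simp: algebra_simps c)
  qed
  with assms show ?thesis
    by (cases v) (fastforce split: if_splits)+
qed


section \<open>The action is faithful\<close>

global_interpretation bts: endomorphism "bts u" for u
  by unfold_locales (rule endo_bts)

lemma cst_of_int: "cst (of_int n) = of_int n"
  by (cases n rule: int_cases2) (simp_all add: cst_of_nat cst_minus)

lemma bts_of_int: "bts u (of_int n) = of_int n"
  using bts.cst[of u "of_int n"] by (simp add: cst_of_int)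

fun axis_coord :: "axis \<Rightarrow> ratfun" where
  "axis_coord E1 = va1 + va2 + va3"
| "axis_coord E2 = va2 + va3"
| "axis_coord E3 = va3"

text \<open>The three coordinates and \<open>1\<close> are linearly independent: compare partial derivatives in the parameters.\<close>

lemma axis_coord_independent:
  assumes "of_int s * axis_coord i + of_int m = axis_coord j"
  shows "i = j" "s = 1" "m = 0"
proof -
  have int: "pd v (of_int n) = 0" for v n
    using pd.cst[of v "of_int n"] by (simp add: cst_of_int)
  have d: "of_int s * pd v (axis_coord i) = pd v (axis_coord j)" for v
    using arg_cong[OF assms, of "pd v"] by (simp add: pd.add pd.mult int)
  have "of_int s = (1 :: ratfun)"
    using d[of VA3] by (cases i; cases j) (simp_all add: pd.add pd_indet)
  then show s: "s = 1" by simp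
  show "i = j"
    using d[of VA1] d[of VA2] by (cases i; cases j) (simp_all add: pd.add pd_indet s)
  with assms s show "m = 0" by simp
qed

lemma bts_axis_word:
  "bts (axis_word i b) (axis_coord j) =
    (if i = j then (if b then 2 else 0) - axis_coord j else axis_coord j)"
  by (cases i; cases j; cases b) (simp_all add: bt_expand algebra_simps)

lemma bts_dihedral_word:
  "bts (dihedral_word i v) (axis_coord j) =
    (if i = j then of_int (fst (affine_image v)) * axis_coord j + of_int (snd (affine_image v))
     else axis_coord j)"
proof (induction v)
  case (Cons b v)
  show ?case
    by (simp add: dihedral_word_simps Cons.IH bts.add bts.mult bts_of_int bts_axis_word case_prod_beta Let_def
        algebra_simps)
qed (simp add: dihedral_word_simps)

lemma bts_perm_word:
  "s \<in> perm_words \<Longrightarrow> bts s (axis_coord j) = axis_coord (foldr axis_perm s j)"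
  by (cases j) (auto simp: perm_words_def bt_expand algebra_simps)

text \<open>
  The coordinate \<open>e\<^sub>j\<close> is first permuted to \<open>e\<^sub>k\<close> by \<open>\<sigma>\<close>, and then only the dihedral factor of the axis
  \<open>k\<close> acts on it. Independence of the coordinates forces \<open>k = j\<close> and a trivial affine map.
\<close>

lemma bts_normal_word_eq_id:
  assumes "\<And>i. distinct_adj (v i)" "s \<in> perm_words" "bts (normal_word v s) = id"
  shows "normal_word v s = []"
proof -
  have "foldr axis_perm s j = j \<and> affine_image (v (foldr axis_perm s j)) = (1, 0)" for j
  proof -
    define k where "k = foldr axis_perm s j"
    have "bts (normal_word v s) (axis_coord j) =
        of_int (fst (affine_image (v k))) * axis_coord k + of_int (snd (affine_image (v k)))"
      using assms(2) by (cases k)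
        (simp_all add: normal_word_def bts_perm_word bts_dihedral_word bts.add bts.mult bts_of_int
            del: axis_coord.simps flip: k_def)
    with assms(3) have "of_int (fst (affine_image (v k))) * axis_coord k + of_int (snd (affine_image (v k))) = axis_coord j"
      by simp
    from axis_coord_independent[OF this] show ?thesis
      by (metis k_def prod.collapse)
  qed
  then have perm: "foldr axis_perm s j = j" and "affine_image (v j) = (1, 0)" for j
    by metis+
  then have "v j = []" for j
    using affine_image_alternating assms(1) by blast
  moreover have "s = []"
    using assms(2) perm[of E1] perm[of E2] perm[of E3] by (auto simp: perm_words_def)
  ultimately show ?thesis by (simp add: normal_word_def dihedral_word_simps)
qed

lemma bts_cong:
  assumes "word_eq D42_relators u v"
  shows "bts (map fst u) = bts (map fst v)"
  using assms
proof (induction rule: word_eq.induct)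
  case (relator r)
  have "bts (map fst r) f = f" for f
    using relator unfolding D42_relators_def coxeter_relator_def
    by (auto simp: eval_nat_numeral bt_relations)
  then show ?case by auto
qed (auto simp: fun_eq_iff)

text \<open>Pass to the normal form of the word, which acts in the same way and is therefore empty.\<close>

lemma bts_eq_id: "bts u = id \<Longrightarrow> refls u = 1"
proof -
  assume u: "bts u = id"
  obtain v s where n: "\<forall>i. distinct_adj (v i)" "s \<in> perm_words" "refls u = refls (normal_word v s)"
    using normal_word_exists by blast
  have "word_eq D42_relators (map (\<lambda>i. (i, True)) u) (map (\<lambda>i. (i, True)) (normal_word v s))"
    using n(3) by (simp add: word_eq_iff comp_def)
  from bts_cong[OF this] u have "bts (normal_word v s) = id"
    by (simp add: comp_def)
  with n bts_normal_word_eq_id have "normal_word v s = []" by blast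
  with n(3) show ?thesis by simp
qed

lemma bts_eq_iff: "bts (map fst u) = bts (map fst v) \<longleftrightarrow> word_eq D42_relators u v"
proof
  assume eq: "bts (map fst u) = bts (map fst v)"
  have "bts (rev w) (bts w f) = f" for w f
    by (induction w arbitrary: f) simp_all
  with eq have "bts (rev (map fst u) @ map fst v) = id"
    by (simp add: fun_eq_iff) metis
  then have "refls (rev (map fst u)) * refls (map fst v) = 1"
    using bts_eq_id by fastforce
  moreover have "refls w * (refls (rev w) * x) = x" for w x
    by (induction w arbitrary: x) (simp_all add: mult.assoc)
  ultimately show "word_eq D42_relators u v"
    unfolding word_eq_iff by (metis mult_1_right)
qed (rule bts_cong)

lemma baecklund_comp: "baecklund \<phi> \<Longrightarrow> baecklund \<psi> \<Longrightarrow> baecklund (\<phi> \<circ> \<psi>)"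
  by (simp add: baecklund_def field_aut_def bij_comp)

lemma baecklund_bts: "baecklund (bts u)"
proof (induction u)
  case Nil
  have "bij (\<lambda>f :: ratfun. f)" using bij_id by (simp add: id_def)
  then show ?case by (simp add: baecklund_def field_aut_def)
next
  case (Cons i u)
  then show ?case
    unfolding foldr.simps by (rule baecklund_comp[OF baecklund_bt])
qed

lemma carrier_subgroup_generated_bt:
  "carrier (subgroup_generated baecklund_group (range bt)) = range bts"
proof -
  interpret group baecklund_group by (rule group_baecklund_group)
  have carrier: "bts u \<in> carrier baecklund_group" for u
    by (simp add: baecklund_group_def baecklund_bts)
  have bt: "bt i = bts [i]" for i by auto
  have comp: "bts u \<otimes>\<^bsub>baecklund_group\<^esub> bts w = bts (u @ w)" for u w
    by (simp add: baecklund_mult baecklund_bts fun_eq_iff)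
  have one: "\<one>\<^bsub>baecklund_group\<^esub> = bts []"
  proof -
    have "bts [] \<otimes>\<^bsub>baecklund_group\<^esub> bts [] = bts []"
      unfolding comp by (simp only: append_Nil)
    then show ?thesis
      unfolding l_cancel_one[OF carrier carrier] by (rule HOL.sym)
  qed
  have "f \<in> range bts" if "f \<in> generate baecklund_group (range bt)" for f
    using that
  proof induction
    case one
    show ?case unfolding \<open>\<one>\<^bsub>baecklund_group\<^esub> = bts []\<close> by blast
  next
    case (incl f)
    then obtain i where "f = bt i" by blast
    then show ?case using bt by blast
  next
    case (inv f)
    then obtain i where f: "f = bts [i]" using bt by blast
    have "f \<otimes>\<^bsub>baecklund_group\<^esub> f = \<one>\<^bsub>baecklund_group\<^esub>"
      unfolding f comp one by (simp add: fun_eq_iff)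
    then have "inv\<^bsub>baecklund_group\<^esub> f = f"
      unfolding f by (intro inv_equality carrier)
    with f show ?case by blast
  next
    case (eng f g)
    then show ?case using comp by blast
  qed
  moreover have "bts u \<in> generate baecklund_group (range bt)" for u
  proof (induction u)
    case Nil
    show ?case unfolding one[symmetric] by (rule generate.one)
  next
    case (Cons i u)
    have "bts [i] \<in> generate baecklund_group (range bt)"
      unfolding bt[symmetric] by (intro generate.incl) simp
    from generate.eng[OF this Cons.IH] show ?case unfolding comp by (simp only: append.simps)
  qed
  moreover have "carrier baecklund_group \<inter> range bt = range bt"
    by (auto simp: baecklund_group_def baecklund_bt)
  ultimately show ?thesis
    unfolding carrier_subgroup_generated by auto
qed

text \<open>
  A class of words is sent to the composite of the transformations along any of its
  representatives. It is well defined by the Coxeter relations and injective by faithfulness.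
\<close>

theorem theorem3p1:
  shows "(\<forall>i. bt i \<in> carrier baecklund_group \<and> map (bt i) coords = images i) \<and>
    (\<exists>\<Phi>. \<Phi> \<in> iso affine_Weyl_D42 (subgroup_generated baecklund_group (range bt)) \<and>
         (\<forall>i. \<Phi> (simple_reflection i) = bt i))"
proof (intro conjI allI)
  show "bt i \<in> carrier baecklund_group" for i
    by (simp add: baecklund_group_def baecklund_bt)
  show "map (bt i) coords = images i" for i
    by (rule bt_coords)
  define \<Phi> where "\<Phi> A = bts (map fst (SOME u. A = word_class D42_relators u))" for A
  have \<Phi>: "\<Phi> (word_class D42_relators u) = bts (map fst u)" for u
  proof -
    have "word_class D42_relators u = word_class D42_relators (SOME w. word_class D42_relators u = word_class D42_relators w)"
      by (rule someI[where x = u]) simp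
    then show ?thesis
      unfolding \<Phi>_def by (metis bts_cong word_class_eq_iff)
  qed
  have carrier: "carrier affine_Weyl_D42 = range (word_class D42_relators)"
    by (simp add: affine_Weyl_D42_def presented_group_def)
  have "\<Phi> \<in> hom affine_Weyl_D42 (subgroup_generated baecklund_group (range bt))"
  proof (rule homI)
    fix A B assume "A \<in> carrier affine_Weyl_D42" "B \<in> carrier affine_Weyl_D42"
    then obtain u w where "A = word_class D42_relators u" "B = word_class D42_relators w"
      by (auto simp: carrier)
    then show "\<Phi> (A \<otimes>\<^bsub>affine_Weyl_D42\<^esub> B) =
        \<Phi> A \<otimes>\<^bsub>subgroup_generated baecklund_group (range bt)\<^esub> \<Phi> B"
      by (simp add: affine_Weyl_D42_def presented_group_mult \<Phi> baecklund_mult baecklund_bts fun_eq_iff)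
  qed (auto simp: carrier carrier_subgroup_generated_bt \<Phi>)
  moreover have "bij_betw \<Phi> (carrier affine_Weyl_D42) (range bts)"
  proof (rule bij_betw_imageI)
    show "inj_on \<Phi> (carrier affine_Weyl_D42)"
      by (auto simp: inj_on_def carrier \<Phi> bts_eq_iff word_class_eq_iff)
    have "bts u \<in> \<Phi> ` range (word_class D42_relators)" for u
      by (rule image_eqI[where x = "word_class D42_relators (map (\<lambda>i. (i, True)) u)"])
        (simp_all add: \<Phi> comp_def)
    then show "\<Phi> ` carrier affine_Weyl_D42 = range bts"
      unfolding carrier by (auto simp: \<Phi>)
  qed
  moreover have "\<Phi> (simple_reflection i) = bt i" for i
    by (simp add: simple_reflection_def \<Phi>)
  ultimately show "\<exists>\<Phi>. \<Phi> \<in> iso affine_Weyl_D42 (subgroup_generated baecklund_group (range bt)) \<and>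
      (\<forall>i. \<Phi> (simple_reflection i) = bt i)"
    by (intro exI[of _ \<Phi>]) (simp add: iso_def carrier_subgroup_generated_bt)
qed

end
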